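(* Consider the balanced push-started Lu-Kumar network, with $m_1+m_3+m_4=m_2+m_5=1$ and tie-breaking rule $1>3>4$ at station 1. There exists $\bar\alpha\in(0,1)$ (depending on the mean service times $m_1,\dots,m_5$) such that if $\alpha_1>\bar\alpha$ and (i) the nominal-load condition is satisfied: $\rho_1=\rho_2<1$ (equivalently, $\alpha_1<1$), (ii) $m_2m_4>m_3m_5$, then the network is robustly queue-ratio stable.
   Context: Push-started Lu-Kumar network: $J=2$ stations, $K=5$ classes. Jobs arrive exogenously only to class $1$, at rate $\alpha_1$, and follow the deterministic route $1\to2\to3\to4\to5\to$ exit (so $P_{k,k+1}=1$ for $k=1,\dots,4$, all other $P_{kl}=0$, $\alpha=(\alpha_1,0,\dots,0)'$). Station 1 serves classes $1,3,4$; station 2 serves classes $2,5$; $s(k)$ is the station serving class $k$. $m_k>0$ is the mean service time of class $k$, $M=\mathrm{diag}(m_1,\dots,m_5)$, $C$ is the $2\times5$ matrix with $C_{jk}=1$ if $s(k)=j$ and $0$ otherwise, $Q=(I-P')^{-1}$, $\rho=CMQ\alpha$, $e$ is the all-ones vector. The network is balanced if $\rho_1=\rho_2$; time is normalized so that the common value of $m_1+m_3+m_4$ and $m_2+m_5$ is $1$. A ratio matrix (encoding a queue-ratio policy) is a nonnegative $K\times J$ matrix $\Delta$ with $\Delta_{kj}=0$ if $s(k)\ne j$, and $CM\Delta=I$. When $CMQ\Delta$ is invertible, $R_\Delta=(CMQ\Delta)^{-1}$ and $\theta_\Delta=R_\Delta(\rho-e)$. Fluid model under $\Delta$. A solution consists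 of Lipschitz functions on $[0,\infty)$ satisfying: $\bar Z(t)=\bar Z(0)+\alpha t-(I-P')M^{-1}\bar T(t)\ge 0$; $\bar W(t)=CM\bar Z(t)$; $\bar\epsilon(t)=\bar Z(t)-\Delta\bar W(t)$; $\bar T(0)=0$ and $\bar T$ is nondecreasing; $\bar Y(t)=et-C\bar T(t)$ is nondecreasing; $\int_0^\infty \bar W_j(s)\,d\bar Y_j(s)=0$ for each $j$; and for each class $k$ and each time $t$ of differentiability, $\bar\epsilon_k^+(t)\bigl(1-\dot{\bar T}{}_k^+(t)\bigr)=0$, where $\bar\epsilon_k^+(t)=\sum_{i\le k:\,s(i)=s(k),\,\bar\epsilon_i(t)>0}\bar\epsilon_i(t)$ and $\dot{\bar T}{}_k^+(t)=\sum_{i\le k:\,s(i)=s(k),\,\bar\epsilon_i(t)>0}\dot{\bar T}_i(t)$. (Among classes of a station with $\bar\epsilon>0$, the lowest index has priority; at station 1 this is the tie-breaking rule $1>3>4$.) State-space collapse (SSC) under $\Delta$: for every fluid solution there is $t_0\ge0$ (possibly depending on $\bar Z(0)$) with $\bar Z(t)=\Delta\bar W(t)$ for all $t\ge t_0$. Skorohod problem (SP) with data $(R,\theta)$: given $\bar W(0)\ge0$, a pair of continuous functions $(\bar Y,\bar W)$ is a solution if $\bar W(t)=\bar W(0)+\theta t+R\bar Y(t)\ge0$, $\bar Y(0)=0$, $\bar Y$ is nondecreasing, and $\int_0^\infty\bar W_j(t)\,d\bar Y_j(t)=0$ for all $j$. It is stable if for every solution there is $T<\infty$ with $\bar W(t)=0$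 for all $t\ge T$. After state-space collapse the fluid workload $\bar W$ solves the SP with data $(R_\Delta,\theta_\Delta)$. Robust queue-ratio stability of the network: for every ratio matrix $\Delta$, the fluid model satisfies SSC, $CMQ\Delta$ is invertible, and the SP with data $(R_\Delta,\theta_\Delta)$ is stable (so that the collapsed fluid workload empties in finite time). *)

theory Defs
  imports "HOL-Analysis.Analysis"
begin

datatype station = S1 | S2

datatype job_class = K1 | K2 | K3 | K4 | K5

lemma UNIV_station: "(UNIV :: station set) = {S1, S2}"
  using station.exhaust by auto

lemma UNIV_job_class: "(UNIV :: job_class set) = {K1, K2, K3, K4, K5}"
  using job_class.exhaust by auto

instance station :: finite
  by standard (simp add: UNIV_station)

instance job_class :: finite
  by standard (simp add: UNIV_job_class)

fun class_index :: "job_class \<Rightarrow> nat" where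
  "class_index K1 = 1"
| "class_index K2 = 2"
| "class_index K3 = 3"
| "class_index K4 = 4"
| "class_index K5 = 5"

fun server :: "job_class \<Rightarrow> station" where
  "server K1 = S1"
| "server K2 = S2"
| "server K3 = S1"
| "server K4 = S1"
| "server K5 = S2"

text \<open>In \<^typ>\<open>real ^ 'c ^ 'r\<close> the rows are indexed by \<open>'r\<close> and the columns by \<open>'c\<close>.\<close>

definition routing :: "real ^ job_class ^ job_class" where
  "routing = (\<chi> k l. if class_index l = class_index k + 1 then 1 else 0)"

definition arrival :: "real \<Rightarrow> real ^ job_class" where
  "arrival \<alpha>\<^sub>1 = (\<chi> k. if k = K1 then \<alpha>\<^sub>1 else 0)"

definition constituency :: "real ^ job_class ^ station" where
  "constituency = (\<chi> j k. if server k = j then 1 else 0)"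

definition service :: "real ^ job_class \<Rightarrow> real ^ job_class ^ job_class" where
  "service m = (\<chi> k l. if k = l then m $ k else 0)"

definition visits :: "real ^ job_class ^ job_class" where
  "visits = matrix_inv (mat 1 - transpose routing)"

definition load :: "real ^ job_class \<Rightarrow> real \<Rightarrow> real ^ station" where
  "load m \<alpha>\<^sub>1 = (constituency ** service m ** visits) *v arrival \<alpha>\<^sub>1"

definition ratio_matrix :: "real ^ job_class \<Rightarrow> real ^ station ^ job_class \<Rightarrow> bool" where
  "ratio_matrix m \<Delta> \<longleftrightarrow>
     (\<forall>k j. 0 \<le> \<Delta> $ k $ j) \<and>
     (\<forall>k j. server k \<noteq> j \<longrightarrow> \<Delta> $ k $ j = 0) \<and>
     constituency ** service m ** \<Delta> = mat 1"

definition reflection_inv ::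
  "real ^ job_class \<Rightarrow> real ^ station ^ job_class \<Rightarrow> real ^ station ^ station" where
  "reflection_inv m \<Delta> = constituency ** service m ** visits ** \<Delta>"

definition reflection ::
  "real ^ job_class \<Rightarrow> real ^ station ^ job_class \<Rightarrow> real ^ station ^ station" where
  "reflection m \<Delta> = matrix_inv (reflection_inv m \<Delta>)"

definition drift ::
  "real ^ job_class \<Rightarrow> real \<Rightarrow> real ^ station ^ job_class \<Rightarrow> real ^ station" where
  "drift m \<alpha>\<^sub>1 \<Delta> = reflection m \<Delta> *v (load m \<alpha>\<^sub>1 - vec 1)"

text \<open>
  The Lebesgue--Stieltjes integral of a nonnegative \<open>w\<close> over \<open>[0,\<infinity>)\<close> against a continuous
  nondecreasing \<open>y\<close> on \<open>[0,\<infinity>)\<close>. As \<^const>\<open>interval_measure\<close> takes a function on the whole line,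
  \<open>y\<close> is extended by the constant \<open>y 0\<close> to the left of \<open>0\<close>. The integral is taken in
  \<^typ>\<open>ennreal\<close>, so that it vanishes only if \<open>w = 0\<close> almost everywhere with respect to \<open>dy\<close>.
\<close>

definition stieltjes_integral :: "(real \<Rightarrow> real) \<Rightarrow> (real \<Rightarrow> real) \<Rightarrow> ennreal" where
  "stieltjes_integral w y =
     (\<integral>\<^sup>+t\<in>{0..}. ennreal (w t) \<partial>interval_measure (\<lambda>t. y (max 0 t)))"

text \<open>
  For the classes \<open>i\<close> at the station of \<open>k\<close> with \<open>i \<le> k\<close> and \<open>\<epsilon>\<^sub>i > 0\<close>, the sum of the entries of
  \<open>x\<close>: with \<open>x = \<epsilon>(t)\<close> this is \<open>\<epsilon>\<^sub>k\<^sup>+(t)\<close>, and with \<open>x\<close> the derivative of \<open>T\<close> at \<open>t\<close> it is the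
  allocation rate to these classes.
\<close>

definition priority_sum :: "real ^ job_class \<Rightarrow> real ^ job_class \<Rightarrow> job_class \<Rightarrow> real" where
  "priority_sum \<epsilon> x k =
     (\<Sum>i | class_index i \<le> class_index k \<and> server i = server k \<and> \<epsilon> $ i > 0. x $ i)"

definition lipschitz_path :: "(real \<Rightarrow> real ^ 'n) \<Rightarrow> bool" where
  "lipschitz_path f \<longleftrightarrow> (\<exists>L. L-lipschitz_on {0..} f)"

definition fluid_solution ::
  "real ^ job_class \<Rightarrow> real \<Rightarrow> real ^ station ^ job_class \<Rightarrow>
   (real \<Rightarrow> real ^ job_class) \<Rightarrow> (real \<Rightarrow> real ^ station) \<Rightarrow> (real \<Rightarrow> real ^ job_class) \<Rightarrow>
   (real \<Rightarrow> real ^ job_class) \<Rightarrow> (real \<Rightarrow> real ^ station) \<Rightarrow> bool" where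
  "fluid_solution m \<alpha>\<^sub>1 \<Delta> Z W \<epsilon> T Y \<longleftrightarrow>
     lipschitz_path Z \<and> lipschitz_path W \<and> lipschitz_path \<epsilon> \<and>
     lipschitz_path T \<and> lipschitz_path Y \<and>
     (\<forall>t\<ge>0. Z t = Z 0 + t *\<^sub>R arrival \<alpha>\<^sub>1
              - ((mat 1 - transpose routing) ** matrix_inv (service m)) *v T t) \<and>
     (\<forall>t\<ge>0. \<forall>k. 0 \<le> Z t $ k) \<and>
     (\<forall>t\<ge>0. W t = (constituency ** service m) *v Z t) \<and>
     (\<forall>t\<ge>0. \<epsilon> t = Z t - \<Delta> *v W t) \<and>
     T 0 = 0 \<and>
     (\<forall>k. mono_on {0..} (\<lambda>t. T t $ k)) \<and>
     (\<forall>t\<ge>0. Y t = t *\<^sub>R vec 1 - constituency *v T t) \<and>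
     (\<forall>j. mono_on {0..} (\<lambda>t. Y t $ j)) \<and>
     (\<forall>j. stieltjes_integral (\<lambda>t. W t $ j) (\<lambda>t. Y t $ j) = 0) \<and>
     (\<forall>t>0. \<forall>D. (T has_vector_derivative D) (at t) \<longrightarrow>
        (\<forall>k. priority_sum (\<epsilon> t) (\<epsilon> t) k * (1 - priority_sum (\<epsilon> t) D k) = 0))"

definition state_space_collapse ::
  "real ^ job_class \<Rightarrow> real \<Rightarrow> real ^ station ^ job_class \<Rightarrow> bool" where
  "state_space_collapse m \<alpha>\<^sub>1 \<Delta> \<longleftrightarrow>
     (\<forall>Z W \<epsilon> T Y. fluid_solution m \<alpha>\<^sub>1 \<Delta> Z W \<epsilon> T Y \<longrightarrow>
        (\<exists>t\<^sub>0\<ge>0. \<forall>t\<ge>t\<^sub>0. Z t = \<Delta> *v W t))"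

definition skorohod_solution ::
  "real ^ 'j ^ 'j \<Rightarrow> real ^ 'j \<Rightarrow> (real \<Rightarrow> real ^ 'j) \<Rightarrow> (real \<Rightarrow> real ^ 'j) \<Rightarrow> bool" where
  "skorohod_solution R \<theta> Y W \<longleftrightarrow>
     continuous_on {0..} Y \<and> continuous_on {0..} W \<and>
     (\<forall>t\<ge>0. W t = W 0 + t *\<^sub>R \<theta> + R *v Y t) \<and>
     (\<forall>t\<ge>0. \<forall>j. 0 \<le> W t $ j) \<and>
     Y 0 = 0 \<and>
     (\<forall>j. mono_on {0..} (\<lambda>t. Y t $ j)) \<and>
     (\<forall>j. stieltjes_integral (\<lambda>t. W t $ j) (\<lambda>t. Y t $ j) = 0)"

definition skorohod_stable :: "real ^ 'j ^ 'j \<Rightarrow> real ^ 'j \<Rightarrow> bool" where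
  "skorohod_stable R \<theta> \<longleftrightarrow>
     (\<forall>Y W. skorohod_solution R \<theta> Y W \<longrightarrow> (\<exists>t\<^sub>0\<ge>0. \<forall>t\<ge>t\<^sub>0. W t = 0))"

definition robustly_queue_ratio_stable :: "real ^ job_class \<Rightarrow> real \<Rightarrow> bool" where
  "robustly_queue_ratio_stable m \<alpha>\<^sub>1 \<longleftrightarrow>
     (\<forall>\<Delta>. ratio_matrix m \<Delta> \<longrightarrow>
        state_space_collapse m \<alpha>\<^sub>1 \<Delta> \<and>
        invertible (reflection_inv m \<Delta>) \<and>
        skorohod_stable (reflection m \<Delta>) (drift m \<alpha>\<^sub>1 \<Delta>))"

lemma sum_job_class: "(\<Sum>k\<in>UNIV. f k) = f K1 + f K2 + f K3 + f K4 + f K5"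
  for f :: "job_class \<Rightarrow> 'a::comm_monoid_add"
  by (simp add: UNIV_job_class add.assoc)

lemma visits_eq: "visits = (\<chi> k l. if class_index l \<le> class_index k then 1 else 0)" (is "_ = ?V")
proof -
  have all: "(\<forall>k. P k) \<longleftrightarrow> P K1 \<and> P K2 \<and> P K3 \<and> P K4 \<and> P K5" for P
    by (metis job_class.exhaust)
  let ?A = "mat 1 - transpose routing"
  have inv: "?A ** ?V = mat 1" "?V ** ?A = mat 1"
    by (simp_all add: vec_eq_iff matrix_matrix_mult_def sum_job_class all mat_def transpose_def
        routing_def)
  then have ex: "\<exists>B. ?A ** B = mat 1 \<and> B ** ?A = mat 1"
    by blast
  have "visits ** ?A = mat 1"
    unfolding visits_def matrix_inv_def using someI_ex[OF ex] by (rule conjunct2)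
  then have "visits ** (?A ** ?V) = ?V"
    by (simp only: matrix_mul_assoc matrix_mul_lid)
  then show ?thesis
    by (simp only: inv(1) matrix_mul_rid)
qed

lemma load_eq:
  "load m \<alpha>\<^sub>1 $ S1 = \<alpha>\<^sub>1 * (m $ K1 + m $ K3 + m $ K4)"
  "load m \<alpha>\<^sub>1 $ S2 = \<alpha>\<^sub>1 * (m $ K2 + m $ K5)"
  by (simp_all add: load_def visits_eq matrix_vector_mult_def matrix_matrix_mult_def sum_job_class
      constituency_def service_def arrival_def algebra_simps)

end

theory Submission
  imports Defs
begin

text \<open>
  State-space collapse is a chain of one-dimensional descent arguments, valid at almost every time
  because Lipschitz functions are differentiable almost everywhere. The condition
  \<open>m\<^sub>2 m\<^sub>4 > m\<^sub>3 m\<^sub>5\<close> together with \<open>m\<^sub>1 + m\<^sub>3 + m\<^sub>4 = m\<^sub>2 + m\<^sub>5 = 1\<close> forces \<open>m\<^sub>3 < m\<^sub>2\<close>, so class 3 is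
  served faster than class 2 can feed it. Hence \<open>\<epsilon>\<^sub>1\<close>, then \<open>\<epsilon>\<^sub>3\<close>, then \<open>\<epsilon>\<^sub>4\<close> become and stay nonpositive; as their
  weighted sum is \<open>0\<close>, station 1 has collapsed. From then on its departure rates are explicit functions
  of that of class 2, and for \<open>\<alpha>\<^sub>1\<close> close to \<open>1\<close> they drive \<open>\<epsilon>\<^sub>2\<close> to \<open>0\<close> from either side.
  For the Skorohod problem, \<open>G = C M Q \<Delta>\<close> is nonnegative, the same condition gives \<open>det G > 0\<close>, and
  a weighted maximum of the components of \<open>G W\<close> is a Lyapunov function.
\<close>

section \<open>Lipschitz functions of a real variable\<close>

text \<open>While the deviation of a class is positive and those of higher priority are not, that
  class takes its whole station, so the other rates there vanish. At station 1 this cuts class 4 off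
  from class 3; besides the external arrivals, the only inflow to be beaten is that from class 2
  into class 3, at rate at most \<open>1 / m\<^sub>2\<close>. Station 2 is harder because of a loop:
  the inflows into classes 2 and 5 come from station 1, whose rates depend in turn on class 2. After
  the collapse of station 1 all of them are governed by one number, the derivative of its workload.
  If this is nonnegative, class 1 releases at most \<alpha>; if it is negative, station 1 also
  releases stock into classes 2 and 5. The two directions for \<open>\<epsilon>\<^sub>2\<close> need
  \<open>m\<^sub>2 (1 - m\<^sub>1 \<alpha>) \<le> m\<^sub>3 + m\<^sub>4\<close> and
  \<open>m\<^sub>5 (1 - m\<^sub>1 \<alpha>) < m\<^sub>4\<close>. At \<alpha> = 1 the bracket is
  \<open>m\<^sub>3 + m\<^sub>4\<close>, and the second inequality becomes exactly
  \<open>m\<^sub>3 m\<^sub>5 < m\<^sub>2 m\<^sub>4\<close>: hence the threshold for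
  \<alpha>.\<close>

lemma continuous_on_le_if_steps_right:
  fixes H :: "real \<Rightarrow> real"
  assumes "c \<le> d" and cont: "continuous_on {c..d} H"
    and step: "\<And>x. c \<le> x \<Longrightarrow> x < d \<Longrightarrow> \<exists>y. x < y \<and> y \<le> d \<and> H y \<le> H x"
  shows "H d \<le> H c"
proof -
  \<comment> \<open>Real induction: \<open>S\<close> is closed, so it contains its supremum, and the
    step available there would lead beyond it if it were less than \<open>d\<close>. One point to
    the right of each \<open>x\<close> suffices, which fits slopes known only along a
    sequence.\<close>
  define S where "S = {x \<in> {c..d}. H x \<le> H c}"
  have "closed S" unfolding S_def
    by (intro continuous_on_closed_Collect_le continuous_intros cont)
  moreover have bdd: "bdd_above S" by (rule bdd_aboveI[of _ d]) (simp add: S_def)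
  moreover have "S \<noteq> {}" using \<open>c \<le> d\<close> by (auto simp: S_def intro: exI[of _ c])
  ultimately have sup: "Sup S \<in> S" by (intro closed_contains_Sup)
  have "Sup S = d"
  proof (rule ccontr)
    assume "Sup S \<noteq> d"
    then obtain y where "Sup S < y" "y \<in> S"
      using sup step[of "Sup S"] by (fastforce simp: S_def)
    then show False using cSup_upper[OF _ bdd, of y] by simp
  qed
  then show ?thesis using sup by (simp add: S_def)
qed

text \<open>
  \<open>F\<close> is compared with the primitive of \<open>p\<close> plus \<open>K - p\<close> on an open set containing the complement
  of \<open>E\<close> in the interval.
\<close>

lemma lipschitz_on_increase_le:
  fixes F :: "real \<Rightarrow> real"
  assumes lip: "K-lipschitz_on {c..d} F" and "c \<le> d" "p \<le> K" and [measurable]: "E \<in> sets borel"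
    and slope: "\<And>x. x \<in> E \<Longrightarrow> c \<le> x \<Longrightarrow> x < d \<Longrightarrow> \<exists>\<^sub>F y in at_right x. F y - F x \<le> p * (y - x)"
  shows "F d - F c \<le> p * (d - c) + (K - p) * measure lborel ({c..d} - E)"
proof -
  have "F d - F c \<le> p * (d - c) + (K - p) * measure lborel ({c..d} - E) + (K - p) * \<eta>" if "\<eta> > 0" for \<eta>
  proof -
    \<comment> \<open>Openness of the cover is what matters: at a point outside \<open>E\<close> a
      whole interval to the right lies in \<open>U\<close>, where \<open>V\<close> has slope
      \<open>K\<close> and the Lipschitz bound gives the step. Outer regularity keeps the price of
      enlarging the set below \<eta>.\<close>
    obtain U where U: "open U" "{c..d} - E \<subseteq> U"
      and U_small: "emeasure lborel (U - ({c..d} - E)) < ennreal \<eta>"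
      using outer_regular_lborel[of "{c..d} - E" \<eta>] \<open>\<eta> > 0\<close> by auto
    have [measurable]: "U \<in> sets borel" using U by auto
    have fin: "U \<inter> {a..b} \<in> fmeasurable lborel" "U \<inter> {a<..b} \<in> fmeasurable lborel" for a b
      by (auto intro!: fmeasurable_Int_fmeasurable fmeasurableI2[OF fmeasurable_cbox[of a b]] simp: Int_commute[of U])
    define V where "V x = p * x + (K - p) * measure lborel (U \<inter> {c..x})" for x
    have split: "measure lborel (U \<inter> {c..y}) = measure lborel (U \<inter> {c..x}) + measure lborel (U \<inter> {x<..y})"
      if "c \<le> x" "x \<le> y" for x y
    proof -
      have "U \<inter> {c..y} = (U \<inter> {c..x}) \<union> (U \<inter> {x<..y})" using that by auto
      moreover have "(U \<inter> {c..x}) \<inter> (U \<inter> {x<..y}) = {}" by auto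
      ultimately show ?thesis using fin by (metis measure_Un3 measure_empty diff_zero)
    qed
    have gap: "0 \<le> measure lborel (U \<inter> {x<..y})" "measure lborel (U \<inter> {x<..y}) \<le> y - x" if "x \<le> y" for x y
    proof -
      have "measure lborel (U \<inter> {x<..y}) \<le> measure lborel {x<..y}"
        using that by (intro measure_mono_fmeasurable) (auto intro!: fmeasurableI simp: emeasure_lborel_Ioc)
      then show "measure lborel (U \<inter> {x<..y}) \<le> y - x" using that by simp
    qed simp
    have V_diff: "V y - V x = p * (y - x) + (K - p) * measure lborel (U \<inter> {x<..y})"
      if "c \<le> x" "x \<le> y" for x y
      unfolding V_def split[OF that] by (simp add: algebra_simps)
    have V_lip: "\<bar>V y - V x\<bar> \<le> (\<bar>p\<bar> + (K - p)) * \<bar>y - x\<bar>" if "c \<le> x" "c \<le> y" for x y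
    proof -
      have *: "\<bar>V y - V x\<bar> \<le> (\<bar>p\<bar> + (K - p)) * (y - x)" if "c \<le> x" "x \<le> y" for x y
      proof -
        note V_diff[OF that]
        moreover have "\<bar>p * (y - x)\<bar> \<le> \<bar>p\<bar> * (y - x)" using that by (simp add: abs_mult)
        moreover have "\<bar>(K - p) * measure lborel (U \<inter> {x<..y})\<bar> \<le> (K - p) * (y - x)"
          using gap[OF that(2)] \<open>p \<le> K\<close> by (simp add: abs_mult mult_left_mono)
        ultimately show ?thesis by (simp add: distrib_right)
      qed
      show ?thesis using *[of x y] *[of y x] that by (cases "x \<le> y") (auto simp: abs_minus_commute)
    qed
    have V_cont: "continuous_on {c..d} V"
      by (rule lipschitz_on_continuous_on[of "\<bar>p\<bar> + (K - p)"])
        (use V_lip \<open>p \<le> K\<close> in \<open>auto simp: lipschitz_on_def dist_real_def\<close>)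
    have F_cont: "continuous_on {c..d} F" using lip by (rule lipschitz_on_continuous_on)
    have "F d - V d \<le> F c - V c"
    proof (rule continuous_on_le_if_steps_right[of c d "\<lambda>x. F x - V x"])
      fix s assume s: "c \<le> s" "s < d"
      have "\<exists>y. s < y \<and> y \<le> d \<and> F y - F s \<le> V y - V s"
      proof (cases "s \<in> E")
        case True
        from frequently_eventually_conj[OF slope[OF True s(1,2)] eventually_at_right_less]
        have "\<exists>\<^sub>F y in at_right s. s < y \<and> F y - F s \<le> p * (y - s)"
          by (auto elim: frequently_elim1)
        moreover have "\<forall>\<^sub>F y in at_right s. y < d" using s(2) by (metis eventually_at_right_real greaterThanLessThan_iff eventually_mono)
        ultimately obtain y where y: "s < y" "y < d" "F y - F s \<le> p * (y - s)"
          by (metis (mono_tags, lifting) frequently_eventually_conj frequently_ex)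
        have "V y - V s \<ge> p * (y - s)"
          using V_diff[of s y] s y \<open>p \<le> K\<close> by simp
        then show ?thesis using y by force
      next
        case False
        then have "s \<in> U" using s U by auto
        then obtain e where e: "e > 0" "ball s e \<subseteq> U" using \<open>open U\<close> open_contains_ball by blast
        define y where "y = min d (s + e / 2)"
        have y: "s < y" "y \<le> d" "y < s + e" using s e by (auto simp: y_def)
        have "{s<..y} \<subseteq> ball s e" using y by (auto simp: dist_real_def)
        then have "U \<inter> {s<..y} = {s<..y}" using e by auto
        then have "V y - V s = K * (y - s)"
          using V_diff[of s y] s y by (simp add: algebra_simps)
        moreover have "F y - F s \<le> K * (y - s)"
          using lipschitz_onD[OF lip, of y s] s y by (auto simp: dist_real_def)
        ultimately show ?thesis using y by auto
      qed
      then show "\<exists>y. s < y \<and> y \<le> d \<and> F y - V y \<le> F s - V s"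
        by (auto simp: algebra_simps)
    qed (use \<open>c \<le> d\<close> F_cont V_cont in \<open>auto intro: continuous_intros\<close>)
    then have "F d - F c \<le> V d - V c" by simp
    also have "V d - V c \<le> p * (d - c) + (K - p) * measure lborel (U \<inter> {c..d})"
      using \<open>p \<le> K\<close> mult_nonneg_nonneg[of "K - p" "measure lborel (U \<inter> {c..c})"]
      by (simp add: V_def right_diff_distrib)
    also have "(K - p) * measure lborel (U \<inter> {c..d}) \<le> (K - p) * (measure lborel ({c..d} - E) + \<eta>)"
    proof (rule mult_left_mono)
      have Um: "U - ({c..d} - E) \<in> fmeasurable lborel" using U_small
        by (intro fmeasurableI) (auto intro: less_trans)
      have cm: "{c..d} - E \<in> fmeasurable lborel"
        by (rule fmeasurableI2[OF fmeasurable_cbox[of c d]]) auto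
      have "measure lborel (U \<inter> {c..d}) \<le> measure lborel (({c..d} - E) \<union> (U - ({c..d} - E)))"
        by (intro measure_mono_fmeasurable fmeasurable.Un Um cm) auto
      also have "\<dots> \<le> measure lborel ({c..d} - E) + measure lborel (U - ({c..d} - E))"
        by (intro measure_Un_le) auto
      also have "measure lborel (U - ({c..d} - E)) \<le> \<eta>"
        using U_small \<open>\<eta> > 0\<close> by (metis Sigma_Algebra.measure_def enn2real_leI less_imp_le)
      finally show "measure lborel (U \<inter> {c..d}) \<le> measure lborel ({c..d} - E) + \<eta>" by simp
    qed (use \<open>p \<le> K\<close> in simp)
    finally show ?thesis by (simp add: algebra_simps)
  qed
  note bound = this
  show ?thesis
  proof (cases "p = K")
    case True then show ?thesis using bound[of 1] by simp
  next
    case False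
    then have "K - p > 0" using \<open>p \<le> K\<close> by simp
    show ?thesis
    proof (rule field_le_epsilon)
      fix e :: real assume "e > 0"
      then show "F d - F c \<le> p * (d - c) + (K - p) * measure lborel ({c..d} - E) + e"
        using bound[of "e / (K - p)"] \<open>K - p > 0\<close> by simp
    qed
  qed
qed

text \<open>A Vitali argument. Take an open set that exceeds a bounded part \<open>S\<close> of
  \<open>E\<close> by less than \<eta>. Disjoint closed intervals inside it cover almost all of
  \<open>S\<close>, and \<open>E\<close> fills at most the fraction \<theta> of each. So the measure
  of \<open>S\<close> is at most \<theta> times itself plus \<theta> times \<eta>, and \<theta> < 1
  forces it to be 0.\<close>

lemma null_set_if_density_bounded:
  fixes E :: "real set"
  assumes [measurable]: "E \<in> sets borel" and \<theta>: "0 \<le> \<theta>" "\<theta> < 1"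
    and dens: "\<And>c d. c \<le> d \<Longrightarrow> measure lborel (E \<inter> {c..d}) \<le> \<theta> * (d - c)"
  shows "E \<in> null_sets lborel"
proof -
  have bounded: "E \<inter> {a..b} \<in> null_sets lborel" for a b
  proof -
    define S where "S = E \<inter> {a..b}"
    have [measurable]: "S \<in> sets borel" by (simp add: S_def)
    have fin: "S \<in> fmeasurable lborel"
      unfolding S_def by (rule fmeasurableI2[OF fmeasurable_cbox[of a b]]) auto
    have approx: "measure lborel S \<le> \<theta> * (measure lborel S + \<eta>)" if "\<eta> > 0" for \<eta>
    proof -
      obtain U where U: "open U" "S \<subseteq> U" "emeasure lborel (U - S) < ennreal \<eta>"
        using outer_regular_lborel[of S \<eta>] \<open>\<eta> > 0\<close> by auto
      have [measurable]: "U \<in> sets borel" using U by auto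
      define B where "B i = cball (fst i) (snd i)" for i :: "real \<times> real"
      define I where "I = {i. 0 < snd i \<and> B i \<subseteq> U}"
      have cover: "\<exists>i. i \<in> I \<and> x \<in> B i \<and> snd i < e" if "x \<in> S" "0 < e" for x e
      proof -
        obtain r where r: "r > 0" "cball x r \<subseteq> U"
          using open_contains_cball[THEN iffD1, OF U(1)] subsetD[OF U(2) \<open>x \<in> S\<close>] by metis
        have "cball x (min r (e/2)) \<subseteq> cball x r" by (intro subset_cball) simp
        then have "cball x (min r (e/2)) \<subseteq> U" using r(2) by (rule subset_trans)
        then have "(x, min r (e/2)) \<in> I" using r \<open>0 < e\<close> by (simp add: I_def B_def)
        moreover have "x \<in> B (x, min r (e/2))" using r \<open>0 < e\<close> by (simp add: B_def)
        moreover have "snd (x, min r (e/2)) < e" using \<open>0 < e\<close> by simp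
        ultimately show ?thesis by blast
      qed
      obtain C where C: "countable C" "C \<subseteq> I" "pairwise (\<lambda>i j. disjnt (B i) (B j)) C"
        "negligible (S - (\<Union>i\<in>C. B i))"
      proof (rule Vitali_covering_theorem_cballs[of I snd S fst])
        show "0 < snd i" if "i \<in> I" for i using that by (simp add: I_def)
        show "\<exists>i. i \<in> I \<and> x \<in> cball (fst i) (snd i) \<and> snd i < e" if "x \<in> S" "0 < e" for x e
          using cover[OF that] by (simp add: B_def)
      qed (use that in \<open>simp add: B_def\<close>)
      have B_meas [measurable]: "B i \<in> sets borel" for i by (simp add: B_def)
      have UN_meas [measurable]: "(\<Union>i\<in>C. B i) \<in> sets borel" using C(1) by (intro sets.countable_UN') auto
      have disj: "disjoint_family_on B C"
        using C(3) by (simp add: disjoint_family_on_def pairwise_def disjnt_def)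
      then have disj_Int: "disjoint_family_on (\<lambda>i. S \<inter> B i) C"
        unfolding disjoint_family_on_def by blast
      have "S - (\<Union>i\<in>C. B i) \<in> null_sets lborel"
        using C(4) by (simp add: negligible_iff_null_sets null_sets_completion_iff)
      then have "emeasure lborel S = emeasure lborel (S \<inter> (\<Union>i\<in>C. B i))"
        using emeasure_Diff_null_set[of "S - (\<Union>i\<in>C. B i)" lborel S] by (simp add: Diff_Diff_Int)
      also have "S \<inter> (\<Union>i\<in>C. B i) = (\<Union>i\<in>C. S \<inter> B i)" by auto
      also have "emeasure lborel (\<Union>i\<in>C. S \<inter> B i) = (\<integral>\<^sup>+i. emeasure lborel (S \<inter> B i) \<partial>count_space C)"
        by (rule emeasure_UN_countable) (use C(1) disj_Int in auto)
      also have "\<dots> \<le> (\<integral>\<^sup>+i. ennreal \<theta> * emeasure lborel (B i) \<partial>count_space C)"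
      proof (rule nn_integral_mono)
        fix i assume "i \<in> space (count_space C)"
        then have pos: "0 < snd i" using C(2) by (auto simp: I_def)
        have Bi: "B i = {fst i - snd i..fst i + snd i}" by (simp add: B_def cball_eq_atLeastAtMost)
        have m: "E \<inter> B i \<in> fmeasurable lborel"
          unfolding Bi by (rule fmeasurableI2[OF fmeasurable_cbox[of "fst i - snd i" "fst i + snd i"]]) auto
        have "emeasure lborel (S \<inter> B i) \<le> emeasure lborel (E \<inter> B i)"
          by (intro emeasure_mono) (auto simp: S_def)
        also have "\<dots> = ennreal (measure lborel (E \<inter> B i))"
          using m by (simp add: emeasure_eq_measure2)
        also have "\<dots> \<le> ennreal (\<theta> * (2 * snd i))"
          using dens[of "fst i - snd i" "fst i + snd i"] pos unfolding Bi by (intro ennreal_leI) simp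
        also have "\<dots> = ennreal \<theta> * emeasure lborel (B i)"
          using pos \<theta> unfolding Bi by (simp add: ennreal_mult)
        finally show "emeasure lborel (S \<inter> B i) \<le> ennreal \<theta> * emeasure lborel (B i)" .
      qed
      also have "\<dots> = ennreal \<theta> * (\<integral>\<^sup>+i. emeasure lborel (B i) \<partial>count_space C)"
        by (rule nn_integral_cmult) simp
      also have "(\<integral>\<^sup>+i. emeasure lborel (B i) \<partial>count_space C) = emeasure lborel (\<Union>i\<in>C. B i)"
        by (rule emeasure_UN_countable[symmetric]) (use C(1) disj in auto)
      also have "emeasure lborel (\<Union>i\<in>C. B i) \<le> emeasure lborel (S \<union> (U - S))"
        by (rule emeasure_mono) (use C(2) in \<open>auto simp: I_def\<close>)
      also have "\<dots> \<le> emeasure lborel S + emeasure lborel (U - S)"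
        by (rule emeasure_subadditive) auto
      also have "\<dots> \<le> ennreal (measure lborel S) + ennreal \<eta>"
        using U fin by (intro add_mono) (auto simp: emeasure_eq_measure2)
      also have "\<dots> = ennreal (measure lborel S + \<eta>)"
        using \<open>\<eta> > 0\<close> by simp
      finally have "emeasure lborel S \<le> ennreal (\<theta> * (measure lborel S + \<eta>))"
        using \<open>\<eta> > 0\<close> \<theta> by (simp add: ennreal_mult mult_left_mono)
      then show ?thesis
        using fin \<theta> \<open>\<eta> > 0\<close> by (simp add: emeasure_eq_measure2)
    qed
    have "(1 - \<theta>) * measure lborel S \<le> 0 + \<eta>" if "\<eta> > 0" for \<eta>
    proof -
      have "\<theta> * \<eta> \<le> \<eta>" using \<theta> that by (intro mult_left_le_one_le) auto
      then show ?thesis using approx[OF that] by (simp add: algebra_simps)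
    qed
    then have "(1 - \<theta>) * measure lborel S \<le> 0" by (rule field_le_epsilon)
    then have "measure lborel S = 0"
      using \<theta> measure_nonneg[of lborel S] by (simp add: mult_le_0_iff del: measure_nonneg)
    then show ?thesis using fin unfolding S_def[symmetric] by (auto simp: emeasure_eq_measure2 null_sets_def)
  qed
  have "E = (\<Union>n::nat. E \<inter> {-real n..real n})"
  proof -
    have "\<exists>n::nat. x \<in> {-real n..real n}" for x
      using real_arch_simple[of "\<bar>x\<bar>"] by (auto simp: abs_le_iff minus_le_iff)
    then show ?thesis by auto
  qed
  moreover have "(\<Union>n::nat. E \<inter> {-real n..real n}) \<in> null_sets lborel"
    using bounded by (intro null_sets_UN)
  ultimately show ?thesis by simp
qed


text \<open>The point reflection \<open>G x = - F (- x)\<close> exchanges left and right difference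
  quotients without changing their values, and Lebesgue measure is invariant under
  \<open>uminus\<close>.\<close>

lemma lipschitz_on_increase_le_left:
  fixes F :: "real \<Rightarrow> real"
  assumes lip: "K-lipschitz_on {c..d} F" and "c \<le> d" "p \<le> K" and [measurable]: "E \<in> sets borel"
    and slope: "\<And>x. x \<in> E \<Longrightarrow> c < x \<Longrightarrow> x \<le> d \<Longrightarrow> \<exists>\<^sub>F y in at_left x. F x - F y \<le> p * (x - y)"
  shows "F d - F c \<le> p * (d - c) + (K - p) * measure lborel ({c..d} - E)"
proof -
  define G where "G x = - F (- x)" for x
  have "K-lipschitz_on {-d..-c} G"
  proof (rule lipschitz_onI)
    fix x y assume "x \<in> {-d..-c}" "y \<in> {-d..-c}"
    then show "dist (G x) (G y) \<le> K * dist x y"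
      using lipschitz_onD[OF lip, of "- x" "- y"] by (simp add: G_def dist_minus)
  qed (rule lipschitz_on_nonneg[OF lip])
  moreover have "uminus -` E \<in> sets borel"
    using measurable_sets[of uminus borel borel E] by simp
  moreover have "\<exists>\<^sub>F y in at_right x. G y - G x \<le> p * (y - x)"
    if "x \<in> uminus -` E" "-d \<le> x" "x < -c" for x
    using slope[of "-x"] that unfolding at_left_minus frequently_filtermap G_def by simp
  ultimately have "G (-c) - G (-d) \<le> p * (- c - - d) + (K - p) * measure lborel ({-d..-c} - uminus -` E)"
    using \<open>c \<le> d\<close> \<open>p \<le> K\<close> by (intro lipschitz_on_increase_le) auto
  moreover have "measure lborel ({-d..-c} - uminus -` E) = measure lborel ({c..d} - E)"
  proof -
    have "uminus -` ({c..d} - E) = {-d..-c} - uminus -` E" by auto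
    then show ?thesis
      using measure_distr[of uminus lborel borel "{c..d} - E"] by (simp add: lborel_distr_uminus)
  qed
  ultimately show ?thesis by (simp add: G_def)
qed

text \<open>Up to the case of equality, the set where the lower Dini derivative on the given side is
  below \<open>p\<close>. Applied to \<open>- F\<close> and \<open>- q\<close> it is the set where
  the upper one exceeds \<open>q\<close>. With the side passed as a filter, all four Dini
  derivatives are treated at once.\<close>

definition derivate_below :: "(real \<Rightarrow> real filter) \<Rightarrow> (real \<Rightarrow> real) \<Rightarrow> real \<Rightarrow> real set" where
  "derivate_below side F p = {x. \<exists>\<^sub>F y in side x. (F y - F x) / (y - x) < p}"

text \<open>For a fixed step \<open>h\<close> the condition on \<open>x\<close> is open, and so is
  the union over all \<open>h\<close> in a punctured one-sided interval. Frequent occurrence is the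
  intersection over the lengths \<open>inverse (real (Suc n))\<close>, so the set is a countable
  intersection of open sets.\<close>

lemma derivate_below_borel:
  assumes cont: "continuous_on UNIV F" and side: "side \<in> {at_left, at_right}"
  shows "derivate_below side F p \<in> sets borel"
proof -
  have open_set: "open (\<Union>h\<in>H. {x. (F (x + h) - F x) / h < p})" if "0 \<notin> H" for H
    using that cont
    by (intro open_UN ballI open_Collect_less continuous_intros continuous_on_compose2[OF cont]) auto
  have right: "derivate_below at_right F p
    = (\<Inter>n. \<Union>h\<in>{0<..<inverse (real (Suc n))}. {x. (F (x + h) - F x) / h < p})" (is "_ = ?R")
  proof (intro set_eqI iffI)
    fix x assume "x \<in> derivate_below at_right F p"
    then have freq: "\<exists>\<^sub>F y in at_right x. (F y - F x) / (y - x) < p" by (simp add: derivate_below_def)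
    show "x \<in> ?R"
    proof safe
      fix n
      have "\<forall>\<^sub>F y in at_right x. x < y \<and> y < x + inverse (real (Suc n))"
        using eventually_at_right_real[of x "x + inverse (real (Suc n))"] by simp
      from frequently_eventually_conj[OF freq this]
      obtain y where "x < y" "y < x + inverse (real (Suc n))" "(F y - F x) / (y - x) < p"
        by (auto dest: frequently_ex)
      then show "x \<in> (\<Union>h\<in>{0<..<inverse (real (Suc n))}. {x. (F (x + h) - F x) / h < p})"
        by (intro UN_I[of "y - x"]) auto
    qed
  next
    fix x assume x: "x \<in> ?R"
    show "x \<in> derivate_below at_right F p"
      unfolding derivate_below_def frequently_def mem_Collect_eq eventually_at_right_field
    proof safe
      fix b assume b: "x < b" "\<forall>y>x. y < b \<longrightarrow> \<not> (F y - F x) / (y - x) < p"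
      then obtain n where "inverse (real (Suc n)) < b - x" using reals_Archimedean[of "b - x"] by auto
      moreover have "x \<in> (\<Union>h\<in>{0<..<inverse (real (Suc n))}. {x. (F (x + h) - F x) / h < p})"
        using x by (rule INT_D) simp
      then obtain h where "0 < h" "h < inverse (real (Suc n))" "(F (x + h) - F x) / h < p"
        by auto
      ultimately show False using b(2)[rule_format, of "x + h"] by simp
    qed
  qed
  have left: "derivate_below at_left F p
    = (\<Inter>n. \<Union>h\<in>{- inverse (real (Suc n))<..<0}. {x. (F (x + h) - F x) / h < p})" (is "_ = ?R")
  proof (intro set_eqI iffI)
    fix x assume "x \<in> derivate_below at_left F p"
    then have freq: "\<exists>\<^sub>F y in at_left x. (F y - F x) / (y - x) < p" by (simp add: derivate_below_def)
    show "x \<in> ?R"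
    proof safe
      fix n
      have "\<forall>\<^sub>F y in at_left x. x - inverse (real (Suc n)) < y \<and> y < x"
        using eventually_at_left_real[of "x - inverse (real (Suc n))" x] by simp
      from frequently_eventually_conj[OF freq this]
      obtain y where "y < x" "x - inverse (real (Suc n)) < y" "(F y - F x) / (y - x) < p"
        by (auto dest: frequently_ex)
      then show "x \<in> (\<Union>h\<in>{- inverse (real (Suc n))<..<0}. {x. (F (x + h) - F x) / h < p})"
        by (intro UN_I[of "y - x"]) auto
    qed
  next
    fix x assume x: "x \<in> ?R"
    show "x \<in> derivate_below at_left F p"
      unfolding derivate_below_def frequently_def mem_Collect_eq eventually_at_left_field
    proof safe
      fix b assume b: "b < x" "\<forall>y>b. y < x \<longrightarrow> \<not> (F y - F x) / (y - x) < p"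
      then obtain n where "inverse (real (Suc n)) < x - b" using reals_Archimedean[of "x - b"] by auto
      moreover have "x \<in> (\<Union>h\<in>{- inverse (real (Suc n))<..<0}. {x. (F (x + h) - F x) / h < p})"
        using x by (rule INT_D) simp
      then obtain h where "h < 0" "- inverse (real (Suc n)) < h" "(F (x + h) - F x) / h < p"
        by auto
      ultimately show False using b(2)[rule_format, of "x + h"] by simp
    qed
  qed
  have "?thesis" if "side = at_right"
    unfolding that right by (intro sets.countable_INT' image_subsetI borel_open open_set) auto
  moreover have "?thesis" if "side = at_left"
    unfolding that left by (intro sets.countable_INT' image_subsetI borel_open open_set) auto
  ultimately show ?thesis using side by auto
qed

lemma derivate_below_increase_le:
  fixes F :: "real \<Rightarrow> real"
  assumes lip: "K-lipschitz_on UNIV F" and side: "side \<in> {at_left, at_right}"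
    and "c \<le> d" "p \<le> K" "E \<in> sets borel" "E \<subseteq> derivate_below side F p"
  shows "F d - F c \<le> p * (d - c) + (K - p) * measure lborel ({c..d} - E)"
proof -
  have lip': "K-lipschitz_on {c..d} F" using lip by (rule lipschitz_on_subset) simp
  consider "side = at_right" | "side = at_left" using side by auto
  then show ?thesis
  proof cases
    case 1
    have "\<exists>\<^sub>F y in at_right x. F y - F x \<le> p * (y - x)" if "x \<in> E" for x
    proof -
      have "\<exists>\<^sub>F y in at_right x. (F y - F x) / (y - x) < p"
        using that assms(6) 1 by (auto simp: derivate_below_def)
      from frequently_eventually_conj[OF this eventually_at_right_less]
      show ?thesis by (rule frequently_elim1) (auto simp: field_simps)
    qed
    then show ?thesis using assms lip' by (intro lipschitz_on_increase_le) auto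
  next
    case 2
    have "\<exists>\<^sub>F y in at_left x. F x - F y \<le> p * (x - y)" if "x \<in> E" for x
    proof -
      have "\<exists>\<^sub>F y in at_left x. (F y - F x) / (y - x) < p"
        using that assms(6) 2 by (auto simp: derivate_below_def)
      from frequently_eventually_conj[OF this, of "\<lambda>y. y < x"]
      have "\<exists>\<^sub>F y in at_left x. y < x \<and> (F y - F x) / (y - x) < p"
        by (simp add: eventually_at_filter)
      then show ?thesis by (rule frequently_elim1) (auto simp: field_simps)
    qed
    then show ?thesis using assms lip' by (intro lipschitz_on_increase_le_left) auto
  qed
qed

text \<open>On \<open>E\<close> the function can be advanced both with slope below \<open>p\<close>
  and with slope above \<open>q\<close>. The two increase bounds, for \<open>F\<close> and for
  \<open>- F\<close>, add up to an inequality without \<open>F\<close>, which limits the density of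
  \<open>E\<close> in every interval to \<open>2 * M / (2 * M + (q - p)) < 1\<close>.\<close>

lemma derivates_gap_null:
  fixes F :: "real \<Rightarrow> real"
  assumes lip: "K-lipschitz_on UNIV F" and "p < q"
    and sides: "s \<in> {at_left, at_right}" "s' \<in> {at_left, at_right}"
  shows "derivate_below s F p \<inter> derivate_below s' (\<lambda>x. - F x) (- q) \<in> null_sets lborel"
proof -
  define E where "E = derivate_below s F p \<inter> derivate_below s' (\<lambda>x. - F x) (- q)"
  \<comment> \<open>A positive Lipschitz constant that dominates both slopes \<open>p\<close> and
    \<open>- q\<close>, as the increase bound requires.\<close>
  define M where "M = max K (max \<bar>p\<bar> \<bar>q\<bar>) + 1"
  have M: "p \<le> M" "- q \<le> M" "0 < M" "K \<le> M" using lipschitz_on_nonneg[OF lip] by (auto simp: M_def)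
  have lipM: "M-lipschitz_on UNIV F" using lip M(4) by (rule lipschitz_on_le)
  have lipM': "M-lipschitz_on UNIV (\<lambda>x. - F x)" using lipM by (simp add: lipschitz_on_def dist_minus)
  have cont: "continuous_on UNIV F" "continuous_on UNIV (\<lambda>x. - F x)"
    using lipM lipM' lipschitz_on_continuous_on by blast+
  have [measurable]: "E \<in> sets borel"
    unfolding E_def using cont sides by (intro sets.Int derivate_below_borel)
  have E_sub: "E \<subseteq> derivate_below s F p" "E \<subseteq> derivate_below s' (\<lambda>x. - F x) (- q)"
    by (auto simp: E_def)
  have "E \<in> null_sets lborel"
  proof (rule null_set_if_density_bounded)
    show "0 \<le> 2 * M / (2 * M + (q - p))" "2 * M / (2 * M + (q - p)) < 1"
      using M \<open>p < q\<close> by auto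
    fix c d :: real assume "c \<le> d"
    have fin: "{c..d} \<inter> E \<in> fmeasurable lborel" "{c..d} - E \<in> fmeasurable lborel"
      by (auto intro!: fmeasurableI2[OF fmeasurable_cbox[of c d]])
    have "measure lborel {c..d} = measure lborel ({c..d} \<inter> E) + measure lborel ({c..d} - E)"
    proof -
      have "{c..d} \<inter> E \<inter> ({c..d} - E) = {}" by auto
      then show ?thesis using measure_Un3[OF fin] by (simp add: Int_Diff_Un)
    qed
    then have sum: "measure lborel ({c..d} - E) = d - c - measure lborel (E \<inter> {c..d})"
      using \<open>c \<le> d\<close> by (simp add: Int_commute)
    have "F d - F c \<le> p * (d - c) + (M - p) * measure lborel ({c..d} - E)"
      by (rule derivate_below_increase_le[OF lipM sides(1)]) (use \<open>c \<le> d\<close> M in \<open>auto intro: subsetD[OF E_sub(1)] subsetD[OF E_sub(2)]\<close>)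
    moreover have "- F d - - F c \<le> - q * (d - c) + (M - - q) * measure lborel ({c..d} - E)"
      by (rule derivate_below_increase_le[OF lipM' sides(2)]) (use \<open>c \<le> d\<close> M in \<open>auto intro: subsetD[OF E_sub(1)] subsetD[OF E_sub(2)]\<close>)
    ultimately have "(2 * M + (q - p)) * measure lborel (E \<inter> {c..d}) \<le> 2 * M * (d - c)"
      unfolding sum by (simp add: algebra_simps)
    then show "measure lborel (E \<inter> {c..d}) \<le> 2 * M / (2 * M + (q - p)) * (d - c)"
      using M \<open>p < q\<close> by (simp add: field_simps)
  qed simp
  then show ?thesis by (simp add: E_def)
qed

text \<open>Where the difference quotients have no limit, rationals p < q separate their lower from
  their upper limit. Values below \<open>p\<close> and values above \<open>q\<close> both recur,
  each on at least one side, which leaves countably many null sets: one for each pair of rationals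
  and each of the four pairs of sides. The Lipschitz bound makes the limit finite.\<close>

lemma lipschitz_AE_differentiable:
  fixes F :: "real \<Rightarrow> real"
  assumes lip: "K-lipschitz_on UNIV F"
  shows "\<exists>N\<in>null_sets lborel. \<forall>x. x \<notin> N \<longrightarrow> F differentiable at x"
proof -
  define N where "N = (\<Union>(p, q)\<in>{(p, q). p \<in> \<rat> \<and> q \<in> \<rat> \<and> p < q}.
    \<Union>(s, s')\<in>{at_left, at_right} \<times> {at_left, at_right}.
      derivate_below s F p \<inter> derivate_below s' (\<lambda>x. - F x) (- q))"
  have "N \<in> null_sets lborel" unfolding N_def
  proof (intro null_sets_UN', goal_cases)
    case 1
    show ?case by (rule countable_subset[of _ "\<rat> \<times> \<rat>"]) (auto intro: countable_rat)
  next
    case (2 pq)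
    have "(\<Union>(s, s')\<in>{at_left, at_right} \<times> {at_left, at_right}.
      derivate_below s F (fst pq) \<inter> derivate_below s' (\<lambda>x. - F x) (- snd pq)) \<in> null_sets lborel"
      using 2 by (intro null_sets_UN') (auto intro!: derivates_gap_null[OF lip] countable_finite)
    then show ?case by (simp add: case_prod_unfold)
  qed
  moreover have "F differentiable at x" if "x \<notin> N" for x
  proof -
    define g where "g y = (F y - F x) / (y - x)" for y
    have split: "(\<exists>\<^sub>F y in at x. P y) \<longleftrightarrow> (\<exists>\<^sub>F y in at_left x. P y) \<or> (\<exists>\<^sub>F y in at_right x. P y)" for P
      by (simp add: frequently_def eventually_at_split)
    have g_bound: "\<bar>g y\<bar> \<le> K" for y
      using lipschitz_onD[OF lip, of y x] lipschitz_on_nonneg[OF lip]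
      by (auto simp: g_def dist_real_def divide_le_eq)
    let ?l = "Liminf (at x) (\<lambda>y. ereal (g y))" and ?u = "Limsup (at x) (\<lambda>y. ereal (g y))"
    have "?u \<le> ?l"
    proof (rule ccontr)
      assume "\<not> ?u \<le> ?l"
      then obtain b where b: "?l < ereal b" "ereal b < ?u" using ereal_dense2[of ?l ?u] by (auto simp: not_le)
      obtain a where a: "?l < ereal a" "ereal a < ereal b" using ereal_dense2[OF b(1)] by auto
      obtain p where p: "p \<in> \<rat>" "a < p" "p < b" using Rats_dense_in_real[of a b] a by auto
      obtain q where q: "q \<in> \<rat>" "p < q" "q < b" using Rats_dense_in_real[of p b] p by auto
      have "\<exists>\<^sub>F y in at x. g y < p"
      proof (rule ccontr)
        assume "\<not> ?thesis"
        then have "\<forall>\<^sub>F y in at x. ereal p \<le> ereal (g y)" by (simp add: not_frequently not_less)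
        then have "ereal p \<le> ?l" by (rule Liminf_bounded)
        then show False using a p by (metis ereal_less_eq(3) leD less_imp_le order.trans)
      qed
      moreover have "\<exists>\<^sub>F y in at x. q < g y"
      proof (rule ccontr)
        assume "\<not> ?thesis"
        then have "\<forall>\<^sub>F y in at x. ereal (g y) \<le> ereal q" by (simp add: not_frequently not_less)
        then have "?u \<le> ereal q" by (rule Limsup_bounded)
        then show False using b q by (metis ereal_less_eq(3) leD less_imp_le order.trans)
      qed
      moreover have "q < g y \<longleftrightarrow> (- F y - - F x) / (y - x) < - q" for y
        unfolding g_def diff_divide_distrib minus_divide_left by linarith
      ultimately obtain s s' where "s \<in> {at_left, at_right}" "s' \<in> {at_left, at_right}"
        "x \<in> derivate_below s F p" "x \<in> derivate_below s' (\<lambda>x. - F x) (- q)"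
        unfolding split derivate_below_def g_def by auto
      then show False using \<open>x \<notin> N\<close> p q unfolding N_def by blast
    qed
    moreover have "?l \<le> ?u" by (rule Liminf_le_Limsup) simp
    ultimately have eq: "?l = ?u" by simp
    have "ereal (- K) \<le> ?l" "?u \<le> ereal K"
      using g_bound by (auto intro!: Liminf_bounded Limsup_bounded always_eventually simp: abs_le_iff minus_le_iff)
    moreover have "\<exists>D. l = ereal D" if "ereal (- K) \<le> l" "l \<le> ereal K" for l
      using that by (cases l) auto
    ultimately obtain D where "?l = ereal D" using eq by metis
    then have "((\<lambda>y. ereal (g y)) \<longlongrightarrow> ereal D) (at x)"
      using eq by (subst tendsto_iff_Liminf_eq_Limsup) auto
    then have "(g \<longlongrightarrow> D) (at x)" by simp
    then have "(F has_real_derivative D) (at x)"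
      unfolding has_field_derivative_iff g_def .
    then show ?thesis using real_differentiable_def by blast
  qed
  ultimately show ?thesis by blast
qed

lemma lipschitz_path_component:
  assumes "lipschitz_path f"
  obtains L where "L-lipschitz_on {0..} (\<lambda>t. f t $ k)"
proof -
  obtain L where L: "L-lipschitz_on {0..} f" using assms by (auto simp: lipschitz_path_def)
  have "L-lipschitz_on {0..} (\<lambda>t. f t $ k)"
    by (rule lipschitz_onI)
      (use lipschitz_on_nonneg[OF L] in \<open>auto intro: order_trans[OF dist_vec_nth_le lipschitz_onD[OF L]]\<close>)
  then show ?thesis by (rule that)
qed

lemma lipschitz_path_AE_has_vector_derivative:
  fixes f :: "real \<Rightarrow> real ^ 'n"
  assumes "lipschitz_path f"
  shows "\<exists>N\<in>null_sets lborel. \<forall>t>0. t \<notin> N \<longrightarrow> (\<exists>D. (f has_vector_derivative D) (at t))"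
proof -
  \<comment> \<open>The path is controlled only on the half-line. Freezing it at its initial value
    to the left of 0 gives a function that is Lipschitz on the whole line and unchanged near every
    positive time.\<close>
  have "\<exists>N\<in>null_sets lborel. \<forall>t. t \<notin> N \<longrightarrow> (\<lambda>s. f (max 0 s) $ k) differentiable at t" for k
  proof -
    obtain L where L: "L-lipschitz_on {0..} (\<lambda>t. f t $ k)" using assms by (rule lipschitz_path_component)
    have "L-lipschitz_on UNIV (\<lambda>s. f (max 0 s) $ k)"
    proof (rule lipschitz_onI)
      fix s t :: real
      have "dist (f (max 0 s) $ k) (f (max 0 t) $ k) \<le> L * dist (max 0 s) (max 0 t)"
        by (rule lipschitz_onD[OF L]) auto
      also have "\<dots> \<le> L * dist s t"
        using lipschitz_on_nonneg[OF L] by (intro mult_left_mono) (auto simp: dist_real_def)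
      finally show "dist (f (max 0 s) $ k) (f (max 0 t) $ k) \<le> L * dist s t" .
    qed (rule lipschitz_on_nonneg[OF L])
    then show ?thesis by (rule lipschitz_AE_differentiable)
  qed
  then obtain N where N: "\<And>k. N k \<in> null_sets lborel"
    and diff: "\<And>k t. t \<notin> N k \<Longrightarrow> (\<lambda>s. f (max 0 s) $ k) differentiable at t" by metis
  have "(\<Union>k. N k) \<in> null_sets lborel" by (rule null_sets_UN') (use N in \<open>auto intro: countable_finite\<close>)
  moreover have "\<exists>D. (f has_vector_derivative D) (at t)" if "0 < t" "t \<notin> (\<Union>k. N k)" for t
  proof -
    have "\<exists>D. ((\<lambda>s. f s $ k) has_real_derivative D) (at t)" for k
    proof -
      obtain D where "((\<lambda>s. f (max 0 s) $ k) has_real_derivative D) (at t)"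
        using diff[of t k] \<open>t \<notin> _\<close> by (auto simp: real_differentiable_def)
      then have "((\<lambda>s. f s $ k) has_real_derivative D) (at t)"
        by (rule has_field_derivative_transform_within_open[of _ _ _ "{0<..}"]) (use \<open>0 < t\<close> in auto)
      then show ?thesis by blast
    qed
    then obtain D where D: "\<And>k. ((\<lambda>s. f s $ k) has_real_derivative D k) (at t)" by metis
    have "(f has_vector_derivative (\<chi> k. D k)) (at t)"
      unfolding has_vector_derivative_def
    proof (subst has_derivative_componentwise_within, intro ballI)
      fix i :: "real ^ 'n" assume "i \<in> Basis"
      then obtain k where i: "i = axis k 1" by (auto simp: Basis_vec_def)
      show "((\<lambda>s. f s \<bullet> i) has_derivative (\<lambda>x. x *\<^sub>R (\<chi> k. D k) \<bullet> i)) (at t)"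
        using D[of k] unfolding i has_field_derivative_def
        by (simp add: cart_eq_inner_axis[symmetric] mult.commute[of _ "D k"])
    qed
    then show ?thesis by blast
  qed
  ultimately show ?thesis by blast
qed

section \<open>Descent criteria and the complementarity condition\<close>

lemma continuous_on_pos_right:
  fixes g :: "real \<Rightarrow> real"
  assumes "continuous_on {a..} g" "a \<le> t" "0 < g t"
  shows "\<exists>e>0. \<forall>y. t \<le> y \<and> y \<le> t + e \<longrightarrow> 0 < g y"
proof -
  obtain d where d: "d > 0" "\<And>y. a \<le> y \<Longrightarrow> dist y t < d \<Longrightarrow> dist (g y) (g t) < g t"
    using assms unfolding continuous_on_iff by (metis atLeast_iff)
  have "0 < g y" if "t \<le> y \<and> y \<le> t + d / 2" for y
    using d(2)[of y] that \<open>d > 0\<close> \<open>a \<le> t\<close> by (auto simp: dist_real_def abs_if split: if_splits)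
  then show ?thesis using \<open>d > 0\<close> by (intro exI[of _ "d / 2"]) auto
qed

lemma eventually_nonpos_if_decrease:
  fixes f :: "real \<Rightarrow> real"
  assumes cont: "continuous_on {t\<^sub>0..} f" and "k > 0"
    and dec: "\<And>a b. t\<^sub>0 \<le> a \<Longrightarrow> a \<le> b \<Longrightarrow> (\<And>t. t \<in> {a..b} \<Longrightarrow> 0 < f t) \<Longrightarrow> f b \<le> f a - k * (b - a)"
  shows "\<exists>t\<^sub>1\<ge>t\<^sub>0. \<forall>t\<ge>t\<^sub>1. f t \<le> 0"
proof -
  have "\<exists>s\<ge>t\<^sub>0. f s \<le> 0"
  proof (rule ccontr)
    assume "\<not> ?thesis"
    then have pos: "0 < f s" if "t\<^sub>0 \<le> s" for s using that by (meson not_le)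
    have "f (t\<^sub>0 + f t\<^sub>0 / k) \<le> f t\<^sub>0 - k * (f t\<^sub>0 / k)"
      using dec[of t\<^sub>0 "t\<^sub>0 + f t\<^sub>0 / k"] pos \<open>k > 0\<close> by (simp add: less_imp_le)
    moreover have "0 < f (t\<^sub>0 + f t\<^sub>0 / k)" using pos \<open>k > 0\<close> by (simp add: less_imp_le)
    ultimately show False using \<open>k > 0\<close> by simp
  qed
  then obtain s where s: "t\<^sub>0 \<le> s" "f s \<le> 0" by blast
  have "f t \<le> 0" if "s \<le> t" for t
  proof (rule ccontr)
    assume "\<not> f t \<le> 0"
    define S where "S = {x \<in> {s..t}. f x \<le> 0}"
    have cont': "continuous_on {s..t} f" using cont by (rule continuous_on_subset) (use s in auto)
    then have "closed S" unfolding S_def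
      by (intro continuous_on_closed_Collect_le continuous_intros)
    moreover have bdd: "bdd_above S" by (rule bdd_aboveI[of _ t]) (simp add: S_def)
    moreover have "S \<noteq> {}" using \<open>s \<le> t\<close> s by (auto simp: S_def intro: exI[of _ s])
    ultimately have r: "Sup S \<in> S" by (intro closed_contains_Sup)
    define r where "r = Sup S"
    have r: "s \<le> r" "r < t" "f r \<le> 0"
      using r \<open>\<not> f t \<le> 0\<close> by (auto simp: S_def r_def order.order_iff_strict)
    have pos: "0 < f x" if "r < x" "x \<le> t" for x
      using cSup_upper[OF _ bdd, of x] that r unfolding S_def r_def by force
    \<comment> \<open>The decrease is available only where \<open>f\<close> is positive on the whole
      closed interval, which excludes \<open>r\<close> itself. Hence the start at a point
      \<open>u\<close> slightly later, where \<open>f\<close> is still below \<open>f t\<close>;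
      decrease from \<open>u\<close> to \<open>t\<close> is then contradictory.\<close>
    have "continuous_on {t\<^sub>0..} (\<lambda>y. f t - f y)" by (intro continuous_intros cont)
    then obtain e where e: "e > 0" "\<And>y. r \<le> y \<and> y \<le> r + e \<Longrightarrow> 0 < f t - f y"
      using continuous_on_pos_right[of t\<^sub>0 "\<lambda>y. f t - f y" r] r s \<open>\<not> f t \<le> 0\<close> by auto
    define u where "u = min t (r + e)"
    have u: "r < u" "u \<le> t" "u \<le> r + e" using e r by (auto simp: u_def)
    have "f t \<le> f u - k * (t - u)" using u r s pos by (intro dec) auto
    moreover have "0 \<le> k * (t - u)" using u \<open>k > 0\<close> by simp
    moreover have "f u < f t" using e(2)[of u] u by simp
    ultimately show False by simp
  qed
  then show ?thesis using s by blast
qed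

text \<open>A Lipschitz function cannot grow on a null set, so the increase bound with a null
  exceptional set turns the derivative into a true rate of decrease. Passing from \<open>c\<close>
  to \<open>c / 2\<close> makes the bound strict, so that it holds for nearby difference
  quotients.\<close>

lemma eventually_nonpos_if_AE_derivative_neg:
  fixes f :: "real \<Rightarrow> real"
  assumes lip: "K-lipschitz_on {t\<^sub>0..} f" and N: "N \<in> null_sets lborel" and "c > 0"
    and deriv: "\<And>t. t\<^sub>0 < t \<Longrightarrow> t \<notin> N \<Longrightarrow> 0 < f t \<Longrightarrow> \<exists>D\<le>-c. (f has_real_derivative D) (at t)"
  shows "\<exists>t\<^sub>1\<ge>t\<^sub>0. \<forall>t\<ge>t\<^sub>1. f t \<le> 0"
proof (rule eventually_nonpos_if_decrease)
  show "continuous_on {t\<^sub>0..} f" using lip by (rule lipschitz_on_continuous_on)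
  show "c / 2 > 0" using \<open>c > 0\<close> by simp
  fix a b assume ab: "t\<^sub>0 \<le> a" "a \<le> b" and pos: "\<And>t. t \<in> {a..b} \<Longrightarrow> 0 < f t"
  have [measurable]: "N \<in> sets borel" using N by (auto simp: null_sets_def)
  define E where "E = {a<..<b} - N"
  have "f b - f a \<le> - (c / 2) * (b - a) + (K - - (c / 2)) * measure lborel ({a..b} - E)"
  proof (rule lipschitz_on_increase_le)
    show "K-lipschitz_on {a..b} f" using lip by (rule lipschitz_on_subset) (use ab in auto)
    show "- (c / 2) \<le> K" using lipschitz_on_nonneg[OF lip] \<open>c > 0\<close> by simp
    show "\<exists>\<^sub>F y in at_right x. f y - f x \<le> - (c / 2) * (y - x)" if x: "x \<in> E" for x
    proof -
      obtain D where D: "D \<le> - c" "(f has_real_derivative D) (at x)"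
        using deriv[of x] pos[of x] x ab by (auto simp: E_def)
      from D(2) have "((\<lambda>y. (f y - f x) / (y - x)) \<longlongrightarrow> D) (at_right x)"
        unfolding has_field_derivative_iff by (rule filterlim_at_split[THEN iffD1, THEN conjunct2])
      moreover have "D < - (c / 2)" using D \<open>c > 0\<close> by simp
      ultimately have "\<forall>\<^sub>F y in at_right x. (f y - f x) / (y - x) < - (c / 2)"
        by (rule order_tendstoD)
      moreover have "\<forall>\<^sub>F y in at_right x. x < y" by (rule eventually_at_right_less)
      ultimately have "\<forall>\<^sub>F y in at_right x. f y - f x \<le> - (c / 2) * (y - x)"
        by eventually_elim (simp add: pos_divide_less_eq)
      then show ?thesis by (simp add: eventually_frequently)
    qed
  qed (use ab in \<open>auto simp: E_def\<close>)
  moreover have "{a..b} - E \<in> null_sets lborel"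
  proof (rule null_sets_subset)
    show "{a, b} \<union> N \<in> null_sets lborel"
      by (intro null_sets.Un N finite_imp_null_set_lborel) simp
  qed (auto simp: E_def)
  then have "measure lborel ({a..b} - E) = 0" by (simp add: measure_eq_0_null_sets)
  ultimately show "f b \<le> f a - c / 2 * (b - a)" by simp
qed

text \<open>By compactness \<open>w\<close> has a positive minimum on the interval; this minimum
  times the increment of \<open>y\<close> is bounded by the vanishing integral.\<close>

lemma stieltjes_integral_zero_imp_constant:
  assumes zero: "stieltjes_integral w y = 0"
    and w: "continuous_on {0..} w" and y: "continuous_on {0..} y" and mono: "mono_on {0..} y"
    and ab: "0 \<le> a" "a \<le> b" and pos: "\<And>t. t \<in> {a..b} \<Longrightarrow> 0 < w t"
  shows "y b = y a"
proof -
  define F where "F t = y (max 0 t)" for t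
  have F_mono: "F s \<le> F t" if "s \<le> t" for s t
    unfolding F_def using that by (intro mono_onD[OF mono]) auto
  have F_cont: "continuous_on UNIV F"
    unfolding F_def by (rule continuous_on_compose2[OF y]) (auto intro!: continuous_intros)
  obtain z where z: "z \<in> {a..b}" "\<And>t. t \<in> {a..b} \<Longrightarrow> w z \<le> w t"
    using continuous_attains_inf[of "{a..b}" w] continuous_on_subset[OF w, of "{a..b}"] ab by auto
  let ?\<mu> = "interval_measure F"
  have "ennreal (w z) * emeasure ?\<mu> {a..b} = (\<integral>\<^sup>+t. ennreal (w z) * indicator {a..b} t \<partial>?\<mu>)"
    by (simp add: nn_integral_cmult_indicator)
  also have "\<dots> \<le> (\<integral>\<^sup>+t\<in>{0..}. ennreal (w t) \<partial>?\<mu>)"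
    using z ab by (intro nn_integral_mono) (auto simp: indicator_def intro!: ennreal_leI)
  also have "\<dots> = 0" using zero unfolding stieltjes_integral_def F_def .
  finally have "emeasure ?\<mu> {a..b} = 0" using pos[OF z(1)] by simp
  then have "F b - F a \<le> 0"
    using emeasure_interval_measure_Icc[OF ab(2) F_mono F_cont] by (simp add: ennreal_eq_0_iff)
  then show ?thesis using F_mono[OF ab(2)] ab by (simp add: F_def max_def)
qed

section \<open>The Skorohod problem with two stations\<close>

lemma sum_station: "(\<Sum>j\<in>UNIV. f j) = f S1 + f S2"
  for f :: "station \<Rightarrow> 'a::comm_monoid_add"
  by (simp add: UNIV_station)

lemma all_station: "(\<forall>j. P j) \<longleftrightarrow> P S1 \<and> P S2"
  by (metis station.exhaust)

lemma matrix_mul_matrix_inv: "invertible A \<Longrightarrow> A ** matrix_inv A = mat 1"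
  unfolding invertible_def matrix_inv_def by (rule someI_ex[THEN conjunct1])

lemma invertible_station_matrix:
  fixes G :: "real ^ station ^ station"
  assumes "G $ S1 $ S1 * G $ S2 $ S2 - G $ S1 $ S2 * G $ S2 $ S1 \<noteq> 0"
  shows "invertible G"
proof -
  let ?d = "G $ S1 $ S1 * G $ S2 $ S2 - G $ S1 $ S2 * G $ S2 $ S1"
  \<comment> \<open>The adjugate divided by the determinant: diagonal entries exchanged, the others
    negated.\<close>
  let ?H = "(\<chi> i j. (if i = j then G $ (if i = S1 then S2 else S1) $ (if i = S1 then S2 else S1)
     else - G $ i $ j) / ?d) :: real ^ station ^ station"
  have "G ** ?H = mat 1" "?H ** G = mat 1"
    using assms by (simp_all add: vec_eq_iff matrix_matrix_mult_def sum_station all_station mat_def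
        diff_divide_distrib[symmetric] mult.commute)
  then show ?thesis unfolding invertible_def by blast
qed

text \<open>
  In the coordinates \<open>V = G W\<close> each component has slope \<open>r\<^sub>j < 0\<close> except while it is pushed by \<open>Y\<^sub>j\<close>.
  The weights in \<open>max (a\<^sub>1 V\<^sub>1) (a\<^sub>2 V\<^sub>2)\<close> are such that \<open>W\<^sub>j > 0\<close>, and hence no push occurs,
  for every \<open>j\<close> attaining the maximum; that such weights exist is the condition \<open>det G > 0\<close>.
\<close>

lemma skorohod_stable_if_det_pos:
  fixes G :: "real ^ station ^ station" and r :: "real ^ station"
  assumes diag: "0 < G $ S1 $ S1" "0 < G $ S2 $ S2"
    and offdiag: "0 \<le> G $ S1 $ S2" "0 \<le> G $ S2 $ S1"
    and det: "G $ S1 $ S2 * G $ S2 $ S1 < G $ S1 $ S1 * G $ S2 $ S2"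
    and r: "r $ S1 < 0" "r $ S2 < 0"
  shows "skorohod_stable (matrix_inv G) (matrix_inv G *v r)"
  unfolding skorohod_stable_def
proof (intro allI impI)
  fix Y W assume "skorohod_solution (matrix_inv G) (matrix_inv G *v r) Y W"
  then have Y_cont: "continuous_on {0..} Y" and W_cont: "continuous_on {0..} W"
    and W_eq: "\<And>t. t \<ge> 0 \<Longrightarrow> W t = W 0 + t *\<^sub>R (matrix_inv G *v r) + matrix_inv G *v Y t"
    and W_nonneg: "\<And>t j. t \<ge> 0 \<Longrightarrow> 0 \<le> W t $ j"
    and Y_mono: "\<And>j. mono_on {0..} (\<lambda>t. Y t $ j)"
    and compl: "\<And>j. stieltjes_integral (\<lambda>t. W t $ j) (\<lambda>t. Y t $ j) = 0"
    unfolding skorohod_solution_def by blast+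
  have inv: "G ** matrix_inv G = mat 1"
    using invertible_station_matrix[of G] det by (intro matrix_mul_matrix_inv) simp
  define V where "V t = G *v W t" for t
  have V_eq: "V t = V 0 + t *\<^sub>R r + (Y t - Y 0)" if "0 \<le> t" for t
  proof -
    have *: "V t = G *v W 0 + t *\<^sub>R r + Y t" if "0 \<le> t" for t
      unfolding V_def by (subst W_eq[OF that])
        (simp add: matrix_vector_right_distrib matrix_vector_mult_scaleR matrix_vector_mul_assoc inv)
    show ?thesis using *[OF that] *[of 0] by simp
  qed
  have V_eq_comp: "V t $ j = V 0 $ j + t * r $ j + (Y t $ j - Y 0 $ j)" if "0 \<le> t" for t j
    using arg_cong[OF V_eq[OF that], of "\<lambda>v. v $ j"] by simp
  have W_comp_cont: "continuous_on {0..} (\<lambda>t. W t $ j)" and Y_comp_cont: "continuous_on {0..} (\<lambda>t. Y t $ j)" for j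
    using W_cont Y_cont by (auto intro: continuous_on_component)
  have V_comp: "V t $ j = G $ j $ S1 * W t $ S1 + G $ j $ S2 * W t $ S2" for t j
    by (simp add: V_def matrix_vector_mult_def sum_station)
  have V_cont: "continuous_on {0..} (\<lambda>t. V t $ j)" for j
    unfolding V_comp by (intro continuous_intros W_comp_cont)
  \<comment> \<open>The ratio of the weights has to lie strictly between
    \<open>G\<^sub>2\<^sub>1 / G\<^sub>1\<^sub>1\<close> and
    \<open>G\<^sub>2\<^sub>2 / G\<^sub>1\<^sub>2\<close>, an interval that is nonempty exactly if
    the determinant is positive. The choice is the mediant of these fractions, which stays
    meaningful for \<open>G\<^sub>1\<^sub>2 = 0\<close>.\<close>
  define a where "a j = (if j = S1 then G $ S2 $ S2 + G $ S2 $ S1 else G $ S1 $ S1 + G $ S1 $ S2)" for j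
  have a_pos: "0 < a j" for j using diag offdiag by (simp add: a_def)
  have weights: "a S1 * G $ S1 $ S2 < a S2 * G $ S2 $ S2" "a S2 * G $ S2 $ S1 < a S1 * G $ S1 $ S1"
    using det by (simp_all add: a_def algebra_simps)
  define L where "L t = max (a S1 * V t $ S1) (a S2 * V t $ S2)" for t
  define k where "k = min (- (a S1 * r $ S1)) (- (a S2 * r $ S2))"
  have k: "k > 0" using a_pos r by (simp add: k_def mult_pos_neg)
  have k_le: "k \<le> - (a j * r $ j)" for j by (cases j) (auto simp: k_def)
  have L_ge: "a j * V t $ j \<le> L t" for j t by (cases j) (auto simp: L_def)
  have L_cont: "continuous_on {0..} L"
    unfolding L_def by (intro continuous_intros V_cont)
  have W_pos: "0 < W t $ j" if "0 \<le> t" "0 < L t" "a j * V t $ j = L t" for t j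
  proof (rule ccontr)
    assume "\<not> 0 < W t $ j"
    then have "W t $ j = 0" using W_nonneg[OF that(1), of j] by simp
    then have "L t \<le> 0"
    proof (cases j)
      case S1
      then have "a S2 * G $ S2 $ S2 * W t $ S2 \<le> a S1 * G $ S1 $ S2 * W t $ S2"
        using that L_ge[of S2 t] \<open>W t $ j = 0\<close> by (simp add: V_comp)
      then have "W t $ S2 \<le> 0" using weights(1) by (smt (verit) mult_strict_right_mono)
      then show ?thesis using S1 that \<open>W t $ j = 0\<close> W_nonneg[OF that(1), of S2] by (simp add: V_comp)
    next
      case S2
      then have "a S1 * G $ S1 $ S1 * W t $ S1 \<le> a S2 * G $ S2 $ S1 * W t $ S1"
        using that L_ge[of S1 t] \<open>W t $ j = 0\<close> by (simp add: V_comp)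
      then have "W t $ S1 \<le> 0" using weights(2) by (smt (verit) mult_strict_right_mono)
      then show ?thesis using S2 that \<open>W t $ j = 0\<close> W_nonneg[OF that(1), of S1] by (simp add: V_comp)
    qed
    then show False using that by simp
  qed
  \<comment> \<open>A component that attains the maximum is not pushed for a while and falls at
    least at rate \<open>k\<close>; one strictly below the maximum stays below the falling line for
    a while by continuity.\<close>
  have local: "\<exists>e>0. \<forall>y. t \<le> y \<and> y \<le> t + e \<longrightarrow> a j * V y $ j \<le> L t - k * (y - t)"
    if t: "0 \<le> t" "0 < L t" for t j
  proof (cases "a j * V t $ j = L t")
    case True
    obtain e where e: "e > 0" "\<And>y. t \<le> y \<and> y \<le> t + e \<Longrightarrow> 0 < W y $ j"
      using continuous_on_pos_right[OF W_comp_cont t(1) W_pos[OF t True]] by auto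
    have "a j * V y $ j \<le> L t - k * (y - t)" if y: "t \<le> y \<and> y \<le> t + e" for y
    proof -
      have "Y y $ j = Y t $ j"
        by (rule stieltjes_integral_zero_imp_constant[OF compl _ _ Y_mono])
          (use y t e W_comp_cont Y_comp_cont in auto)
      then have "V y $ j = V t $ j + r $ j * (y - t)"
        using V_eq_comp[of y j] V_eq_comp[of t j] t y by (simp add: algebra_simps)
      then have "a j * V y $ j = L t + a j * r $ j * (y - t)"
        using True by (simp add: distrib_left)
      moreover have "k * (y - t) \<le> - (a j * r $ j) * (y - t)" using k_le y by (intro mult_right_mono) auto
      ultimately show ?thesis by simp
    qed
    then show ?thesis using e(1) by blast
  next
    case False
    then have "0 < L t - k * (t - t) - a j * V t $ j" using L_ge[of j t] by simp
    moreover have "continuous_on {0..} (\<lambda>y. L t - k * (y - t) - a j * V y $ j)"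
      by (intro continuous_intros V_cont)
    ultimately obtain e where "e > 0" "\<And>y. t \<le> y \<and> y \<le> t + e \<Longrightarrow> 0 < L t - k * (y - t) - a j * V y $ j"
      using continuous_on_pos_right[of 0 "\<lambda>y. L t - k * (y - t) - a j * V y $ j" t] t(1) by auto
    then show ?thesis by (meson diff_gt_0_iff_gt less_imp_le)
  qed
  have "\<exists>t\<^sub>1\<ge>0. \<forall>t\<ge>t\<^sub>1. L t \<le> 0"
  proof (rule eventually_nonpos_if_decrease[OF L_cont k])
    fix b d :: real assume bd: "0 \<le> b" "b \<le> d" and pos: "\<And>t. t \<in> {b..d} \<Longrightarrow> 0 < L t"
    have "L d + k * d \<le> L b + k * b"
    proof (rule continuous_on_le_if_steps_right[OF bd(2)])
      show "continuous_on {b..d} (\<lambda>t. L t + k * t)"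
        by (intro continuous_intros continuous_on_subset[OF L_cont]) (use bd in auto)
      fix t assume t: "b \<le> t" "t < d"
      obtain e1 where e1: "e1 > 0" "\<And>y. t \<le> y \<and> y \<le> t + e1 \<Longrightarrow> a S1 * V y $ S1 \<le> L t - k * (y - t)"
        using local[of t S1] pos[of t] t bd by auto
      obtain e2 where e2: "e2 > 0" "\<And>y. t \<le> y \<and> y \<le> t + e2 \<Longrightarrow> a S2 * V y $ S2 \<le> L t - k * (y - t)"
        using local[of t S2] pos[of t] t bd by auto
      define y where "y = min d (t + min e1 e2)"
      have y: "t < y" "y \<le> d" "y \<le> t + e1" "y \<le> t + e2" using t e1(1) e2(1) by (auto simp: y_def)
      then have "L y \<le> L t - k * (y - t)" using e1(2)[of y] e2(2)[of y] by (simp add: L_def)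
      then show "\<exists>y. t < y \<and> y \<le> d \<and> L y + k * y \<le> L t + k * t"
        using y by (intro exI[of _ y]) (simp add: algebra_simps)
    qed
    then show "L d \<le> L b - k * (d - b)" by (simp add: algebra_simps)
  qed
  then obtain t\<^sub>1 where t1: "t\<^sub>1 \<ge> 0" "\<And>t. t \<ge> t\<^sub>1 \<Longrightarrow> L t \<le> 0" by blast
  have "W t = 0" if "t \<ge> t\<^sub>1" for t
  proof -
    have "V t $ j \<le> 0" for j
      using L_ge[of j t] t1(2)[OF that] a_pos[of j] by (meson mult_le_0_iff not_le order_trans)
    moreover have W: "0 \<le> W t $ S1" "0 \<le> W t $ S2" using W_nonneg that t1 by auto
    ultimately have "G $ S1 $ S1 * W t $ S1 + G $ S1 $ S2 * W t $ S2 \<le> 0"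
      "G $ S2 $ S1 * W t $ S1 + G $ S2 $ S2 * W t $ S2 \<le> 0" unfolding V_comp[symmetric] by auto
    then have "G $ S1 $ S1 * W t $ S1 \<le> 0" "G $ S2 $ S2 * W t $ S2 \<le> 0"
      using W offdiag mult_nonneg_nonneg[OF offdiag(1) W(2)] mult_nonneg_nonneg[OF offdiag(2) W(1)]
      by linarith+
    then have "W t $ S1 = 0" "W t $ S2 = 0" using diag W by (auto simp: mult_le_0_iff)
    then show ?thesis by (simp add: vec_eq_iff all_station)
  qed
  then show "\<exists>t\<^sub>0\<ge>0. \<forall>t\<ge>t\<^sub>0. W t = 0" using t1 by blast
qed

section \<open>Fluid solutions\<close>

lemma all_job_class: "(\<forall>k. P k) \<longleftrightarrow> P K1 \<and> P K2 \<and> P K3 \<and> P K4 \<and> P K5"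
  by (metis job_class.exhaust)

lemma matrix_inv_eq:
  assumes "A ** B = mat 1" "B ** A = mat 1"
  shows "matrix_inv A = B"
proof -
  have "invertible A" using assms invertible_def by blast
  then have "B ** (A ** matrix_inv A) = B" by (simp add: matrix_mul_matrix_inv)
  then show ?thesis by (simp only: matrix_mul_assoc assms matrix_mul_lid)
qed

lemma matrix_inv_service:
  assumes "\<And>k. 0 < m $ k"
  shows "matrix_inv (service m) = (\<chi> k l. if k = l then 1 / m $ k else 0)"
  using assms[of K1] assms[of K2] assms[of K3] assms[of K4] assms[of K5]
  by (intro matrix_inv_eq)
    (simp_all add: vec_eq_iff matrix_matrix_mult_def sum_job_class all_job_class mat_def service_def)

lemma priority_sum_simps:
  "priority_sum \<epsilon> x K1 = (if \<epsilon> $ K1 > 0 then x $ K1 else 0)"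
  "priority_sum \<epsilon> x K3 = (if \<epsilon> $ K1 > 0 then x $ K1 else 0) + (if \<epsilon> $ K3 > 0 then x $ K3 else 0)"
  "priority_sum \<epsilon> x K4 = (if \<epsilon> $ K1 > 0 then x $ K1 else 0) + (if \<epsilon> $ K3 > 0 then x $ K3 else 0)
    + (if \<epsilon> $ K4 > 0 then x $ K4 else 0)"
  "priority_sum \<epsilon> x K2 = (if \<epsilon> $ K2 > 0 then x $ K2 else 0)"
  "priority_sum \<epsilon> x K5 = (if \<epsilon> $ K2 > 0 then x $ K2 else 0) + (if \<epsilon> $ K5 > 0 then x $ K5 else 0)"
proof -
  have "priority_sum \<epsilon> x k = (\<Sum>i\<in>UNIV. if class_index i \<le> class_index k \<and> server i = server k
      \<and> \<epsilon> $ i > 0 then x $ i else 0)" for k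
    unfolding priority_sum_def by (simp add: sum.inter_filter[symmetric])
  then show
    "priority_sum \<epsilon> x K1 = (if \<epsilon> $ K1 > 0 then x $ K1 else 0)"
    "priority_sum \<epsilon> x K3 = (if \<epsilon> $ K1 > 0 then x $ K1 else 0) + (if \<epsilon> $ K3 > 0 then x $ K3 else 0)"
    "priority_sum \<epsilon> x K4 = (if \<epsilon> $ K1 > 0 then x $ K1 else 0) + (if \<epsilon> $ K3 > 0 then x $ K3 else 0)
      + (if \<epsilon> $ K4 > 0 then x $ K4 else 0)"
    "priority_sum \<epsilon> x K2 = (if \<epsilon> $ K2 > 0 then x $ K2 else 0)"
    "priority_sum \<epsilon> x K5 = (if \<epsilon> $ K2 > 0 then x $ K2 else 0) + (if \<epsilon> $ K5 > 0 then x $ K5 else 0)"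
    by (simp_all add: sum_job_class)
qed

lemma ratio_matrix_sums:
  assumes "ratio_matrix m \<Delta>"
  shows "m $ K1 * \<Delta> $ K1 $ S1 + m $ K3 * \<Delta> $ K3 $ S1 + m $ K4 * \<Delta> $ K4 $ S1 = 1"
    "m $ K2 * \<Delta> $ K2 $ S2 + m $ K5 * \<Delta> $ K5 $ S2 = 1"
proof -
  have "(constituency ** service m ** \<Delta>) $ j $ j = 1" for j
    using assms by (simp add: ratio_matrix_def mat_def)
  from this[of S1] this[of S2]
  show "m $ K1 * \<Delta> $ K1 $ S1 + m $ K3 * \<Delta> $ K3 $ S1 + m $ K4 * \<Delta> $ K4 $ S1 = 1"
    "m $ K2 * \<Delta> $ K2 $ S2 + m $ K5 * \<Delta> $ K5 $ S2 = 1"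
    by (simp_all add: matrix_matrix_mult_def sum_job_class constituency_def service_def)
qed

section \<open>One fluid solution, written out by classes\<close>

locale push_started_lu_kumar_fluid =
  fixes m :: "real ^ job_class" and \<alpha> :: real and \<Delta> :: "real ^ station ^ job_class"
    and Z :: "real \<Rightarrow> real ^ job_class" and W :: "real \<Rightarrow> real ^ station"
    and \<epsilon> T :: "real \<Rightarrow> real ^ job_class" and Y :: "real \<Rightarrow> real ^ station"
  assumes m_pos: "\<And>k. 0 < m $ k"
    and ratio: "ratio_matrix m \<Delta>"
    and fluid: "fluid_solution m \<alpha> \<Delta> Z W \<epsilon> T Y"
begin

text \<open>The one entry of row \<open>k\<close> that a ratio matrix allows to be nonzero. The
  product \<open>m $ k * \<delta> k\<close> is the share of class \<open>k\<close> in the workload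
  of its station; the shares add up to 1.\<close>

definition \<delta> :: "job_class \<Rightarrow> real" where
  "\<delta> k = \<Delta> $ k $ server k"

lemma \<delta>_nonneg: "0 \<le> \<delta> k"
  using ratio by (simp add: ratio_matrix_def \<delta>_def)

lemma \<delta>_sums: "m $ K1 * \<delta> K1 + m $ K3 * \<delta> K3 + m $ K4 * \<delta> K4 = 1" "m $ K2 * \<delta> K2 + m $ K5 * \<delta> K5 = 1"
  using ratio_matrix_sums[OF ratio] by (simp_all add: \<delta>_def)

lemma m_\<delta>_nonneg: "0 \<le> m $ k * \<delta> k"
  using m_pos[of k] \<delta>_nonneg[of k] by simp

lemma paths_lipschitz: "lipschitz_path W" "lipschitz_path \<epsilon>" "lipschitz_path T" "lipschitz_path Y"
  using fluid unfolding fluid_solution_def by blast+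

lemma Z_nonneg: "0 \<le> t \<Longrightarrow> 0 \<le> Z t $ k"
  using fluid unfolding fluid_solution_def by blast

lemma T_mono: "mono_on {0..} (\<lambda>t. T t $ k)"
  using fluid unfolding fluid_solution_def by blast

lemma Y_mono: "mono_on {0..} (\<lambda>t. Y t $ j)"
  using fluid unfolding fluid_solution_def by blast

lemma complementarity: "stieltjes_integral (\<lambda>t. W t $ j) (\<lambda>t. Y t $ j) = 0"
  using fluid unfolding fluid_solution_def by blast

lemma priority_rule:
  "0 < t \<Longrightarrow> (T has_vector_derivative D) (at t) \<Longrightarrow>
    priority_sum (\<epsilon> t) (\<epsilon> t) k * (1 - priority_sum (\<epsilon> t) D k) = 0"
  using fluid unfolding fluid_solution_def by blast

lemma Z_eq:
  assumes "0 \<le> t"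
  shows "Z t $ K1 = Z 0 $ K1 + t * \<alpha> - T t $ K1 / m $ K1"
    "Z t $ K2 = Z 0 $ K2 + T t $ K1 / m $ K1 - T t $ K2 / m $ K2"
    "Z t $ K3 = Z 0 $ K3 + T t $ K2 / m $ K2 - T t $ K3 / m $ K3"
    "Z t $ K4 = Z 0 $ K4 + T t $ K3 / m $ K3 - T t $ K4 / m $ K4"
    "Z t $ K5 = Z 0 $ K5 + T t $ K4 / m $ K4 - T t $ K5 / m $ K5"
proof -
  have "\<forall>t\<ge>0. Z t = Z 0 + t *\<^sub>R arrival \<alpha> - ((mat 1 - transpose routing) ** matrix_inv (service m)) *v T t"
    using fluid unfolding fluid_solution_def by (elim conjE) assumption
  note this[rule_format, OF assms]
  then have "Z t $ k = (Z 0 + t *\<^sub>R arrival \<alpha> - ((mat 1 - transpose routing) ** matrix_inv (service m)) *v T t) $ k" for k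
    by (rule arg_cong)
  from this[of K1] this[of K2] this[of K3] this[of K4] this[of K5]
  show "Z t $ K1 = Z 0 $ K1 + t * \<alpha> - T t $ K1 / m $ K1"
    "Z t $ K2 = Z 0 $ K2 + T t $ K1 / m $ K1 - T t $ K2 / m $ K2"
    "Z t $ K3 = Z 0 $ K3 + T t $ K2 / m $ K2 - T t $ K3 / m $ K3"
    "Z t $ K4 = Z 0 $ K4 + T t $ K3 / m $ K3 - T t $ K4 / m $ K4"
    "Z t $ K5 = Z 0 $ K5 + T t $ K4 / m $ K4 - T t $ K5 / m $ K5"
    by (simp_all add: matrix_inv_service[OF m_pos] matrix_vector_mult_def matrix_matrix_mult_def
        sum_job_class mat_def transpose_def routing_def arrival_def)
qed

lemma W_eq:
  assumes "0 \<le> t"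
  shows "W t $ S1 = m $ K1 * Z t $ K1 + m $ K3 * Z t $ K3 + m $ K4 * Z t $ K4"
    "W t $ S2 = m $ K2 * Z t $ K2 + m $ K5 * Z t $ K5"
proof -
  have "W t = (constituency ** service m) *v Z t"
    using fluid assms unfolding fluid_solution_def by blast
  then show "W t $ S1 = m $ K1 * Z t $ K1 + m $ K3 * Z t $ K3 + m $ K4 * Z t $ K4"
    "W t $ S2 = m $ K2 * Z t $ K2 + m $ K5 * Z t $ K5"
    by (simp_all add: matrix_vector_mult_def matrix_matrix_mult_def sum_job_class constituency_def service_def)
qed

lemma \<epsilon>_eq_diff: "0 \<le> t \<Longrightarrow> \<epsilon> t = Z t - \<Delta> *v W t"
  using fluid unfolding fluid_solution_def by blast

lemma \<epsilon>_eq: "0 \<le> t \<Longrightarrow> \<epsilon> t $ k = Z t $ k - \<delta> k * W t $ server k"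
  using ratio
  by (cases k) (simp_all add: \<epsilon>_eq_diff matrix_vector_mult_def sum_station \<delta>_def ratio_matrix_def)

lemma Y_eq:
  assumes "0 \<le> t"
  shows "Y t $ S1 = t - (T t $ K1 + T t $ K3 + T t $ K4)" "Y t $ S2 = t - (T t $ K2 + T t $ K5)"
proof -
  have "Y t = t *\<^sub>R vec 1 - constituency *v T t"
    using fluid assms unfolding fluid_solution_def by blast
  then show "Y t $ S1 = t - (T t $ K1 + T t $ K3 + T t $ K4)" "Y t $ S2 = t - (T t $ K2 + T t $ K5)"
    by (simp_all add: matrix_vector_mult_def sum_job_class constituency_def)
qed

lemma W_nonneg: "0 \<le> t \<Longrightarrow> 0 \<le> W t $ j"
  using W_eq[of t] Z_nonneg[of t] m_pos by (cases j) (simp_all add: less_imp_le)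

text \<open>As C M \<Delta> is the identity, Z and \<Delta> W carry the same workload at each
  station, so their difference carries none.\<close>

lemma \<epsilon>_balance:
  assumes "0 \<le> t"
  shows "m $ K1 * \<epsilon> t $ K1 + m $ K3 * \<epsilon> t $ K3 + m $ K4 * \<epsilon> t $ K4 = 0"
    "m $ K2 * \<epsilon> t $ K2 + m $ K5 * \<epsilon> t $ K5 = 0"
proof -
  have "m $ K1 * \<epsilon> t $ K1 + m $ K3 * \<epsilon> t $ K3 + m $ K4 * \<epsilon> t $ K4
    = W t $ S1 - (m $ K1 * \<delta> K1 + m $ K3 * \<delta> K3 + m $ K4 * \<delta> K4) * W t $ S1"
    using assms by (simp add: \<epsilon>_eq W_eq(1) algebra_simps)
  then show "m $ K1 * \<epsilon> t $ K1 + m $ K3 * \<epsilon> t $ K3 + m $ K4 * \<epsilon> t $ K4 = 0"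
    by (simp add: \<delta>_sums)
  have "m $ K2 * \<epsilon> t $ K2 + m $ K5 * \<epsilon> t $ K5 = W t $ S2 - (m $ K2 * \<delta> K2 + m $ K5 * \<delta> K5) * W t $ S2"
    using assms by (simp add: \<epsilon>_eq W_eq(2) algebra_simps)
  then show "m $ K2 * \<epsilon> t $ K2 + m $ K5 * \<epsilon> t $ K5 = 0"
    by (simp add: \<delta>_sums)
qed

text \<open>A class whose target is the entire workload of its station cannot exceed the target.
  This settles the degenerate case in which the guaranteed descent rate, having the factor
  \<open>1 - m $ k * \<delta> k\<close>, would be 0.\<close>

lemma \<epsilon>_nonpos_if_full_ratio:
  assumes "0 \<le> t" "m $ k * \<delta> k = 1"
  shows "\<epsilon> t $ k \<le> 0"
proof -
  have "m $ k * Z t $ k \<le> W t $ server k"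
    using W_eq[OF assms(1)] Z_nonneg[OF assms(1)] m_pos by (cases k) (simp_all add: less_imp_le)
  then have "\<delta> k * (m $ k * Z t $ k) \<le> \<delta> k * W t $ server k"
    using \<delta>_nonneg by (rule mult_left_mono)
  moreover have "\<delta> k * (m $ k * Z t $ k) = (m $ k * \<delta> k) * Z t $ k" by simp
  ultimately show ?thesis using assms by (simp add: \<epsilon>_eq)
qed

text \<open>Rates of service completion instead of time allocation: the derivative of T is M d. In
  these terms the flow balance of each class is simply inflow minus outflow. Positivity of
  \<open>t\<close> gives a two-sided neighbourhood on which the fluid equations hold.\<close>

definition departure_rates :: "real \<Rightarrow> (job_class \<Rightarrow> real) \<Rightarrow> bool" where
  "departure_rates t d \<longleftrightarrow> 0 < t \<and> (T has_vector_derivative (\<chi> k. m $ k * d k)) (at t)"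

lemma AE_departure_rates:
  obtains N where "N \<in> null_sets lborel" "\<And>t. 0 < t \<Longrightarrow> t \<notin> N \<Longrightarrow> \<exists>d. departure_rates t d"
proof -
  obtain N where N: "N \<in> null_sets lborel"
    and deriv: "\<And>t. 0 < t \<Longrightarrow> t \<notin> N \<Longrightarrow> \<exists>D. (T has_vector_derivative D) (at t)"
    using lipschitz_path_AE_has_vector_derivative[OF paths_lipschitz(3)] by blast
  have "\<exists>d. departure_rates t d" if t: "0 < t" "t \<notin> N" for t
  proof -
    obtain D where "(T has_vector_derivative D) (at t)" using deriv[OF t] by blast
    moreover have "D = (\<chi> k. m $ k * (D $ k / m $ k))"
      using m_pos by (simp add: vec_eq_iff less_imp_neq[symmetric] less_imp_le)
    ultimately show ?thesis unfolding departure_rates_def using \<open>0 < t\<close> by metis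
  qed
  then show ?thesis using N that by blast
qed

section \<open>Flow balance, capacity and priority at a time of differentiability\<close>

context
  fixes t :: real and d :: "job_class \<Rightarrow> real"
  assumes rates: "departure_rates t d"
begin

lemma t_pos: "0 < t"
  using rates by (simp add: departure_rates_def)

lemma T_deriv: "((\<lambda>s. T s $ k) has_real_derivative m $ k * d k) (at t)"
proof -
  have "((\<lambda>s. T s $ k) has_vector_derivative (\<chi> k. m $ k * d k) $ k) (at t)"
    using rates bounded_linear.has_vector_derivative[OF bounded_linear_vec_nth]
    unfolding departure_rates_def by blast
  then show ?thesis by (simp add: has_real_derivative_iff_has_vector_derivative)
qed

lemma rates_nonneg: "0 \<le> d k"
proof -
  have "0 \<le> m $ k * d k"
    by (rule mono_on_imp_deriv_nonneg[OF T_mono T_deriv]) (use t_pos in \<open>simp add: interior_real_atLeast\<close>)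
  then show ?thesis using m_pos[of k] by (simp add: zero_le_mult_iff)
qed

lemma has_derivative_from_eq:
  assumes "(g has_real_derivative D) (at t)" "\<And>s. 0 \<le> s \<Longrightarrow> f s = g s"
  shows "(f has_real_derivative D) (at t)"
  using assms(1)
  by (rule has_field_derivative_transform_within_open[of _ _ _ "{0<..}"]) (use t_pos assms(2) in auto)

lemma T_div_deriv: "((\<lambda>s. T s $ k / m $ k) has_real_derivative d k) (at t)"
  using DERIV_cdivide[OF T_deriv, of k "m $ k"] m_pos[of k] by simp

lemma Z_deriv:
  "((\<lambda>s. Z s $ K1) has_real_derivative \<alpha> - d K1) (at t)"
  "((\<lambda>s. Z s $ K2) has_real_derivative d K1 - d K2) (at t)"
  "((\<lambda>s. Z s $ K3) has_real_derivative d K2 - d K3) (at t)"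
  "((\<lambda>s. Z s $ K4) has_real_derivative d K3 - d K4) (at t)"
  "((\<lambda>s. Z s $ K5) has_real_derivative d K4 - d K5) (at t)"
  by (rule has_derivative_from_eq[OF _ Z_eq(1)],
      rule DERIV_diff[OF DERIV_add[OF DERIV_const DERIV_cmult_right[OF DERIV_ident]] T_div_deriv, simplified], assumption)
    (rule has_derivative_from_eq[OF _ Z_eq(2)] has_derivative_from_eq[OF _ Z_eq(3)]
      has_derivative_from_eq[OF _ Z_eq(4)] has_derivative_from_eq[OF _ Z_eq(5)],
      rule DERIV_diff[OF DERIV_add[OF DERIV_const T_div_deriv] T_div_deriv, simplified], assumption)+

lemma W_deriv:
  "((\<lambda>s. W s $ S1) has_real_derivative
    m $ K1 * (\<alpha> - d K1) + m $ K3 * (d K2 - d K3) + m $ K4 * (d K3 - d K4)) (at t)"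
  "((\<lambda>s. W s $ S2) has_real_derivative m $ K2 * (d K1 - d K2) + m $ K5 * (d K4 - d K5)) (at t)"
  by (rule has_derivative_from_eq[OF _ W_eq(1)], intro DERIV_add DERIV_cmult Z_deriv, assumption)
    (rule has_derivative_from_eq[OF _ W_eq(2)], intro DERIV_add DERIV_cmult Z_deriv, assumption)

lemma \<epsilon>_deriv:
  assumes "((\<lambda>s. Z s $ k) has_real_derivative z) (at t)"
    "((\<lambda>s. W s $ server k) has_real_derivative w) (at t)"
  shows "((\<lambda>s. \<epsilon> s $ k) has_real_derivative z - \<delta> k * w) (at t)"
  by (rule has_derivative_from_eq[OF _ \<epsilon>_eq]) (intro DERIV_diff DERIV_cmult assms)

lemma Y_deriv:
  "((\<lambda>s. Y s $ S1) has_real_derivative 1 - (m $ K1 * d K1 + m $ K3 * d K3 + m $ K4 * d K4)) (at t)"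
  "((\<lambda>s. Y s $ S2) has_real_derivative 1 - (m $ K2 * d K2 + m $ K5 * d K5)) (at t)"
  by (rule has_derivative_from_eq[OF _ Y_eq(1)], intro DERIV_diff DERIV_add T_deriv DERIV_ident, assumption)
    (rule has_derivative_from_eq[OF _ Y_eq(2)], intro DERIV_diff DERIV_add T_deriv DERIV_ident, assumption)

lemma Y_deriv_nonneg: "((\<lambda>s. Y s $ j) has_real_derivative D) (at t) \<Longrightarrow> 0 \<le> D"
  by (rule mono_on_imp_deriv_nonneg[OF Y_mono]) (use t_pos in \<open>auto simp: interior_real_atLeast\<close>)

lemma capacity: "m $ K1 * d K1 + m $ K3 * d K3 + m $ K4 * d K4 \<le> 1" "m $ K2 * d K2 + m $ K5 * d K5 \<le> 1"
  using Y_deriv_nonneg[OF Y_deriv(1)] Y_deriv_nonneg[OF Y_deriv(2)] by simp_all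

text \<open>Non-idling: by continuity the workload stays positive just after \<open>t\<close>, so
  complementarity keeps Y constant there, and the right-hand limit already determines the
  derivative.\<close>

lemma Y_deriv_zero:
  assumes "0 < W t $ j" and deriv: "((\<lambda>s. Y s $ j) has_real_derivative D) (at t)"
  shows "D = 0"
proof -
  have cont: "continuous_on {0..} (\<lambda>s. W s $ j)" "continuous_on {0..} (\<lambda>s. Y s $ j)"
    using lipschitz_path_component[OF paths_lipschitz(1)] lipschitz_path_component[OF paths_lipschitz(4)]
    by (metis lipschitz_on_continuous_on)+
  obtain e where e: "e > 0" "\<And>s. t \<le> s \<and> s \<le> t + e \<Longrightarrow> 0 < W s $ j"
    using continuous_on_pos_right[OF cont(1) _ assms(1)] t_pos by auto
  have "(Y s $ j - Y t $ j) / (s - t) = 0" if "t < s" "s < t + e" for s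
    unfolding divide_eq_0_iff right_minus_eq
    by (rule disjI1, rule stieltjes_integral_zero_imp_constant[OF complementarity cont Y_mono])
      (use that t_pos e in auto)
  then have "\<forall>\<^sub>F s in at_right t. (Y s $ j - Y t $ j) / (s - t) = 0"
    unfolding eventually_at_right_field using e(1) by (intro exI[of _ "t + e"]) simp
  then have "((\<lambda>s. (Y s $ j - Y t $ j) / (s - t)) \<longlongrightarrow> 0) (at_right t)"
    by (rule tendsto_eventually)
  moreover have "((\<lambda>s. (Y s $ j - Y t $ j) / (s - t)) \<longlongrightarrow> D) (at_right t)"
    using deriv unfolding has_field_derivative_iff by (rule filterlim_at_split[THEN iffD1, THEN conjunct2])
  ultimately show ?thesis using tendsto_unique trivial_limit_at_right_real by blast
qed

lemma full_capacity: "0 < W t $ S1 \<Longrightarrow> m $ K1 * d K1 + m $ K3 * d K3 + m $ K4 * d K4 = 1"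
  using Y_deriv_zero[OF _ Y_deriv(1)] by simp

text \<open>Classes of higher priority with nonpositive deviation drop out of both sums, and the
  remaining single positive deviation can be cancelled: the class gets the whole station.\<close>

lemma priority:
  "0 < \<epsilon> t $ K1 \<Longrightarrow> m $ K1 * d K1 = 1"
  "\<epsilon> t $ K1 \<le> 0 \<Longrightarrow> 0 < \<epsilon> t $ K3 \<Longrightarrow> m $ K3 * d K3 = 1"
  "\<epsilon> t $ K1 \<le> 0 \<Longrightarrow> \<epsilon> t $ K3 \<le> 0 \<Longrightarrow> 0 < \<epsilon> t $ K4 \<Longrightarrow> m $ K4 * d K4 = 1"
  "0 < \<epsilon> t $ K2 \<Longrightarrow> m $ K2 * d K2 = 1"
  "\<epsilon> t $ K2 \<le> 0 \<Longrightarrow> 0 < \<epsilon> t $ K5 \<Longrightarrow> m $ K5 * d K5 = 1"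
proof -
  have "priority_sum (\<epsilon> t) (\<epsilon> t) k * (1 - priority_sum (\<epsilon> t) (\<chi> k. m $ k * d k) k) = 0" for k
    using rates priority_rule unfolding departure_rates_def by blast
  from this[of K1] this[of K3] this[of K4] this[of K2] this[of K5]
  show "0 < \<epsilon> t $ K1 \<Longrightarrow> m $ K1 * d K1 = 1"
    "\<epsilon> t $ K1 \<le> 0 \<Longrightarrow> 0 < \<epsilon> t $ K3 \<Longrightarrow> m $ K3 * d K3 = 1"
    "\<epsilon> t $ K1 \<le> 0 \<Longrightarrow> \<epsilon> t $ K3 \<le> 0 \<Longrightarrow> 0 < \<epsilon> t $ K4 \<Longrightarrow> m $ K4 * d K4 = 1"
    "0 < \<epsilon> t $ K2 \<Longrightarrow> m $ K2 * d K2 = 1"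
    "\<epsilon> t $ K2 \<le> 0 \<Longrightarrow> 0 < \<epsilon> t $ K5 \<Longrightarrow> m $ K5 * d K5 = 1"
    by (simp_all add: priority_sum_simps)
qed

end

section \<open>Collapse of station 1, then of station 2\<close>

lemma eventually_nonpos_if_rates:
  assumes lip: "L-lipschitz_on {0..} f" and "0 \<le> t\<^sub>0" "0 < c"
    and deriv: "\<And>t d. departure_rates t d \<Longrightarrow> t\<^sub>0 < t \<Longrightarrow> 0 < f t \<Longrightarrow>
      \<exists>D\<le>-c. (f has_real_derivative D) (at t)"
  shows "\<exists>t\<^sub>1\<ge>t\<^sub>0. \<forall>t\<ge>t\<^sub>1. f t \<le> 0"
proof -
  obtain N where N: "N \<in> null_sets lborel" "\<And>t. 0 < t \<Longrightarrow> t \<notin> N \<Longrightarrow> \<exists>d. departure_rates t d"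
    using AE_departure_rates by metis
  have lip': "L-lipschitz_on {t\<^sub>0..} f" using lip by (rule lipschitz_on_subset) (use assms in auto)
  show ?thesis
  proof (rule eventually_nonpos_if_AE_derivative_neg[OF lip' N(1) \<open>0 < c\<close>])
    fix t assume t: "t\<^sub>0 < t" "t \<notin> N" "0 < f t"
    then obtain d where "departure_rates t d" using N(2)[of t] \<open>0 \<le> t\<^sub>0\<close> by auto
    then show "\<exists>D\<le>-c. (f has_real_derivative D) (at t)" using deriv t by blast
  qed
qed

lemma m_rate_nonneg: "departure_rates t d \<Longrightarrow> 0 \<le> m $ k * d k"
  using rates_nonneg[of t d k] m_pos[of k] by simp

lemma rate_eq_0: "departure_rates t d \<Longrightarrow> m $ k * d k \<le> 0 \<Longrightarrow> d k = 0"
  using m_rate_nonneg[of t d k] m_pos[of k] by simp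

lemma rate_eq: "m $ k * d k = 1 \<Longrightarrow> d k = 1 / m $ k"
  using m_pos[of k] by (simp add: field_simps)

lemma \<epsilon>_lipschitz: obtains L where "L-lipschitz_on {0..} (\<lambda>t. \<epsilon> t $ k)"
  using paths_lipschitz(2) by (rule lipschitz_path_component)

text \<open>Class 1 in full service drains at \<open>1 / m $ K1 - \<alpha>\<close>. Inflow from
  class 2 into class 3 only helps, since it raises the workload and with it the target of class
  1.\<close>

lemma eventually_\<epsilon>1_nonpos:
  assumes "m $ K1 * \<alpha> < 1"
  shows "\<exists>t\<^sub>1\<ge>0. \<forall>t\<ge>t\<^sub>1. \<epsilon> t $ K1 \<le> 0"
proof (cases "m $ K1 * \<delta> K1 = 1")
  case True
  then show ?thesis using \<epsilon>_nonpos_if_full_ratio by blast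
next
  case False
  then have full: "m $ K1 * \<delta> K1 < 1"
    using \<delta>_sums(1) m_\<delta>_nonneg[of K3] m_\<delta>_nonneg[of K4] by linarith
  obtain L where L: "L-lipschitz_on {0..} (\<lambda>t. \<epsilon> t $ K1)" by (rule \<epsilon>_lipschitz)
  define c where "c = (1 / m $ K1 - \<alpha>) * (1 - m $ K1 * \<delta> K1)"
  have "c > 0"
    unfolding c_def using full assms m_pos[of K1] by (intro mult_pos_pos) (simp_all add: field_simps)
  show ?thesis
  proof (rule eventually_nonpos_if_rates[OF L _ \<open>c > 0\<close>])
    fix t d assume r: "departure_rates t d" and "0 < \<epsilon> t $ K1"
    then have m1: "m $ K1 * d K1 = 1" using priority(1) by blast
    then have d: "d K1 = 1 / m $ K1" by (rule rate_eq)
    have "d K3 = 0" "d K4 = 0"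
      using capacity(1)[OF r] m1 m_rate_nonneg[OF r, of K3] m_rate_nonneg[OF r, of K4]
      by (auto intro!: rate_eq_0[OF r])
    note \<epsilon>_deriv[OF r Z_deriv(1)[OF r], unfolded server.simps, OF W_deriv(1)[OF r]]
    \<comment> \<open>The derivative is split into the guaranteed rate \<open>- c\<close> and a
      remainder of favourable sign; the later descents follow the same pattern.\<close>
    moreover have "\<alpha> - d K1 - \<delta> K1 * (m $ K1 * (\<alpha> - d K1) + m $ K3 * (d K2 - d K3) + m $ K4 * (d K3 - d K4))
      = - c - \<delta> K1 * (m $ K3 * d K2)"
      unfolding c_def d[symmetric] by (simp add: \<open>d K3 = 0\<close> \<open>d K4 = 0\<close> algebra_simps)
    moreover have "0 \<le> \<delta> K1 * (m $ K3 * d K2)"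
      using \<delta>_nonneg m_pos[of K3] rates_nonneg[OF r] by (simp add: less_imp_le)
    ultimately show "\<exists>D\<le>-c. ((\<lambda>t. \<epsilon> t $ K1) has_real_derivative D) (at t)"
      by (metis diff_ge_0_iff_ge diff_le_eq add_increasing2 order_refl)
  qed simp
qed

text \<open>Class 3 in full service completes at \<open>1 / m $ K3\<close>, while station 2 can feed
  it at most at \<open>1 / m $ K2\<close>.\<close>

lemma eventually_\<epsilon>3_nonpos:
  assumes "0 \<le> \<alpha>" "m $ K3 < m $ K2" "0 \<le> t\<^sub>0" and \<epsilon>1: "\<And>t. t\<^sub>0 \<le> t \<Longrightarrow> \<epsilon> t $ K1 \<le> 0"
  shows "\<exists>t\<^sub>1\<ge>t\<^sub>0. \<forall>t\<ge>t\<^sub>1. \<epsilon> t $ K3 \<le> 0"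
proof -
  have x: "0 \<le> m $ K3 * \<delta> K3" "m $ K3 * \<delta> K3 \<le> 1"
    using \<delta>_sums(1) m_\<delta>_nonneg[of K1] m_\<delta>_nonneg[of K3] m_\<delta>_nonneg[of K4] by linarith+
  obtain L where L: "L-lipschitz_on {0..} (\<lambda>t. \<epsilon> t $ K3)" by (rule \<epsilon>_lipschitz)
  have pos: "0 < 1 / m $ K3 - 1 / m $ K2"
    using assms(2) m_pos[of K3] m_pos[of K2] by (simp add: field_simps)
  \<comment> \<open>The last term comes from the work that class 3 passes on to class 4 at the same
    station: it raises the target and keeps the rate positive even for
    \<open>m $ K3 * \<delta> K3 = 1\<close>.\<close>
  define c where "c = (1 / m $ K3 - 1 / m $ K2) * (1 - m $ K3 * \<delta> K3) + \<delta> K3 * (m $ K4 * (1 / m $ K3))"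
  have "c > 0"
  proof (cases "\<delta> K3 = 0")
    case True
    then show ?thesis using pos by (simp add: c_def)
  next
    case False
    then have "0 < \<delta> K3 * (m $ K4 * (1 / m $ K3))"
      using \<delta>_nonneg[of K3] m_pos[of K3] m_pos[of K4] by (simp add: less_le)
    moreover have "0 \<le> (1 / m $ K3 - 1 / m $ K2) * (1 - m $ K3 * \<delta> K3)"
      using pos x by (intro mult_nonneg_nonneg) simp_all
    ultimately show ?thesis by (simp add: c_def)
  qed
  show ?thesis
  proof (rule eventually_nonpos_if_rates[OF L \<open>0 \<le> t\<^sub>0\<close> \<open>c > 0\<close>])
    fix t d assume r: "departure_rates t d" and t: "t\<^sub>0 < t" "0 < \<epsilon> t $ K3"
    then have m3: "m $ K3 * d K3 = 1" using priority(2)[OF r] \<epsilon>1[of t] by simp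
    then have d: "d K3 = 1 / m $ K3" by (rule rate_eq)
    have "d K1 = 0" "d K4 = 0"
      using capacity(1)[OF r] m3 m_rate_nonneg[OF r, of K1] m_rate_nonneg[OF r, of K4]
      by (auto intro!: rate_eq_0[OF r])
    have "m $ K2 * d K2 \<le> 1" using capacity(2)[OF r] m_rate_nonneg[OF r, of K5] by linarith
    then have d2: "d K2 \<le> 1 / m $ K2" using m_pos[of K2] by (simp add: field_simps)
    note \<epsilon>_deriv[OF r Z_deriv(3)[OF r], unfolded server.simps, OF W_deriv(1)[OF r]]
    moreover have "d K2 - d K3 - \<delta> K3 * (m $ K1 * (\<alpha> - d K1) + m $ K3 * (d K2 - d K3) + m $ K4 * (d K3 - d K4))
      = - c - ((1 / m $ K2 - d K2) * (1 - m $ K3 * \<delta> K3) + \<delta> K3 * (m $ K1 * \<alpha>))"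
      unfolding c_def d[symmetric] by (simp add: \<open>d K1 = 0\<close> \<open>d K4 = 0\<close> algebra_simps)
    moreover have "0 \<le> (1 / m $ K2 - d K2) * (1 - m $ K3 * \<delta> K3) + \<delta> K3 * (m $ K1 * \<alpha>)"
      using d2 x \<delta>_nonneg m_pos[of K1] \<open>0 \<le> \<alpha>\<close>
      by (intro add_nonneg_nonneg mult_nonneg_nonneg) (simp_all add: less_imp_le)
    ultimately show "\<exists>D\<le>-c. ((\<lambda>t. \<epsilon> t $ K3) has_real_derivative D) (at t)"
      by (metis diff_ge_0_iff_ge diff_le_eq add_increasing2 order_refl)
  qed
qed

text \<open>Class 4 in full service has no inflow, because class 3 is not served. The external
  arrivals raise the target, which gives a positive rate even for share 1.\<close>

lemma eventually_\<epsilon>4_nonpos: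
  assumes "0 < \<alpha>" "0 \<le> t\<^sub>0" and \<epsilon>13: "\<And>t. t\<^sub>0 \<le> t \<Longrightarrow> \<epsilon> t $ K1 \<le> 0" "\<And>t. t\<^sub>0 \<le> t \<Longrightarrow> \<epsilon> t $ K3 \<le> 0"
  shows "\<exists>t\<^sub>1\<ge>t\<^sub>0. \<forall>t\<ge>t\<^sub>1. \<epsilon> t $ K4 \<le> 0"
proof -
  have x: "0 \<le> m $ K4 * \<delta> K4" "m $ K4 * \<delta> K4 \<le> 1"
    using \<delta>_sums(1) m_\<delta>_nonneg[of K1] m_\<delta>_nonneg[of K3] m_\<delta>_nonneg[of K4] by linarith+
  obtain L where L: "L-lipschitz_on {0..} (\<lambda>t. \<epsilon> t $ K4)" by (rule \<epsilon>_lipschitz)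
  define c where "c = 1 / m $ K4 * (1 - m $ K4 * \<delta> K4) + \<delta> K4 * (m $ K1 * \<alpha>)"
  have "c > 0"
  proof (cases "\<delta> K4 = 0")
    case True
    then show ?thesis using m_pos by (simp add: c_def)
  next
    case False
    then have "0 < \<delta> K4 * (m $ K1 * \<alpha>)"
      using \<delta>_nonneg[of K4] m_pos[of K1] \<open>0 < \<alpha>\<close> by (simp add: less_le)
    moreover have "0 \<le> 1 / m $ K4 * (1 - m $ K4 * \<delta> K4)"
      using m_pos[of K4] x by (intro mult_nonneg_nonneg) simp_all
    ultimately show ?thesis by (simp add: c_def)
  qed
  show ?thesis
  proof (rule eventually_nonpos_if_rates[OF L \<open>0 \<le> t\<^sub>0\<close> \<open>c > 0\<close>])
    fix t d assume r: "departure_rates t d" and t: "t\<^sub>0 < t" "0 < \<epsilon> t $ K4"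
    then have m4: "m $ K4 * d K4 = 1" using priority(3)[OF r] \<epsilon>13[of t] by simp
    then have d: "d K4 = 1 / m $ K4" by (rule rate_eq)
    have "d K1 = 0" "d K3 = 0"
      using capacity(1)[OF r] m4 m_rate_nonneg[OF r, of K1] m_rate_nonneg[OF r, of K3]
      by (auto intro!: rate_eq_0[OF r])
    note \<epsilon>_deriv[OF r Z_deriv(4)[OF r], unfolded server.simps, OF W_deriv(1)[OF r]]
    moreover have "d K3 - d K4 - \<delta> K4 * (m $ K1 * (\<alpha> - d K1) + m $ K3 * (d K2 - d K3) + m $ K4 * (d K3 - d K4))
      = - c - \<delta> K4 * (m $ K3 * d K2)"
      unfolding c_def d[symmetric] by (simp add: \<open>d K1 = 0\<close> \<open>d K3 = 0\<close> algebra_simps)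
    moreover have "0 \<le> \<delta> K4 * (m $ K3 * d K2)"
      using \<delta>_nonneg m_rate_nonneg m_pos[of K3] rates_nonneg[OF r] by (simp add: less_imp_le)
    ultimately show "\<exists>D\<le>-c. ((\<lambda>t. \<epsilon> t $ K4) has_real_derivative D) (at t)"
      by (metis diff_ge_0_iff_ge diff_le_eq add_increasing2 order_refl)
  qed
qed

lemma station1_collapse:
  assumes "0 < \<alpha>" "m $ K1 * \<alpha> < 1" "m $ K3 < m $ K2"
  shows "\<exists>t\<^sub>0\<ge>0. \<forall>t\<ge>t\<^sub>0. \<epsilon> t $ K1 = 0 \<and> \<epsilon> t $ K3 = 0 \<and> \<epsilon> t $ K4 = 0"
proof -
  obtain t\<^sub>1 where t1: "0 \<le> t\<^sub>1" "\<And>t. t\<^sub>1 \<le> t \<Longrightarrow> \<epsilon> t $ K1 \<le> 0"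
    using eventually_\<epsilon>1_nonpos[OF assms(2)] by blast
  obtain t\<^sub>2 where t2: "t\<^sub>1 \<le> t\<^sub>2" "\<And>t. t\<^sub>2 \<le> t \<Longrightarrow> \<epsilon> t $ K3 \<le> 0"
    using eventually_\<epsilon>3_nonpos[OF _ assms(3) t1] assms(1) by auto
  obtain t\<^sub>3 where t3: "t\<^sub>2 \<le> t\<^sub>3" "\<And>t. t\<^sub>3 \<le> t \<Longrightarrow> \<epsilon> t $ K4 \<le> 0"
    using eventually_\<epsilon>4_nonpos[OF assms(1) _ _ t2(2)] t1 t2(1) by (meson order_trans)
  have "\<epsilon> t $ K1 = 0 \<and> \<epsilon> t $ K3 = 0 \<and> \<epsilon> t $ K4 = 0" if "t\<^sub>3 \<le> t" for t
  proof -
    have nonpos: "\<epsilon> t $ K1 \<le> 0" "\<epsilon> t $ K3 \<le> 0" "\<epsilon> t $ K4 \<le> 0" using t1 t2 t3 that by auto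
    then have "m $ K1 * \<epsilon> t $ K1 \<le> 0" "m $ K3 * \<epsilon> t $ K3 \<le> 0" "m $ K4 * \<epsilon> t $ K4 \<le> 0"
      using m_pos by (auto simp: mult_le_0_iff less_imp_le)
    moreover have "0 \<le> t" using t1 t2 t3 that by auto
    ultimately have "m $ K1 * \<epsilon> t $ K1 = 0" "m $ K3 * \<epsilon> t $ K3 = 0" "m $ K4 * \<epsilon> t $ K4 = 0"
      using \<epsilon>_balance(1)[of t] by linarith+
    then show ?thesis using m_pos[of K1] m_pos[of K3] m_pos[of K4] by simp
  qed
  moreover have "0 \<le> t\<^sub>3" using t1(1) t2(1) t3(1) by simp
  ultimately show ?thesis by blast
qed

text \<open>Here \<open>w\<close> is the derivative of the workload of station 1. Deviations that
  remain 0 have derivative 0, so each class of the station changes at rate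
  \<open>\<delta> k * w\<close>. If the station is nonempty, full capacity and
  \<open>d K3 = d K2 - \<delta> K3 * w\<close> give a linear equation for \<open>w\<close>.\<close>

lemma station1_collapsed_rates:
  assumes r: "departure_rates t d" and t: "0 \<le> t\<^sub>0" "t\<^sub>0 < t"
    and collapsed: "\<And>s. t\<^sub>0 \<le> s \<Longrightarrow> \<epsilon> s $ K1 = 0 \<and> \<epsilon> s $ K3 = 0 \<and> \<epsilon> s $ K4 = 0"
  obtains w where "\<alpha> - d K1 = \<delta> K1 * w" "d K2 - d K3 = \<delta> K3 * w" "d K3 - d K4 = \<delta> K4 * w"
    "w = 0 \<or> w * (1 + m $ K4 * \<delta> K3) = m $ K1 * \<alpha> + (m $ K3 + m $ K4) * d K2 - 1"
proof -
  define w where "w = m $ K1 * (\<alpha> - d K1) + m $ K3 * (d K2 - d K3) + m $ K4 * (d K3 - d K4)"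
  have zero: "D = 0" if "((\<lambda>s. \<epsilon> s $ k) has_real_derivative D) (at t)" "k \<in> {K1, K3, K4}" for k D
  proof -
    have "((\<lambda>s. 0) has_real_derivative D) (at t)"
      using that(1)
      by (rule has_field_derivative_transform_within_open[of _ _ _ "{t\<^sub>0<..}"])
        (use t collapsed that(2) in auto)
    then show ?thesis using DERIV_const DERIV_unique by blast
  qed
  have eqs: "\<alpha> - d K1 = \<delta> K1 * w" "d K2 - d K3 = \<delta> K3 * w" "d K3 - d K4 = \<delta> K4 * w"
    using zero[OF \<epsilon>_deriv[OF r Z_deriv(1)[OF r], unfolded server.simps, OF W_deriv(1)[OF r]]]
      zero[OF \<epsilon>_deriv[OF r Z_deriv(3)[OF r], unfolded server.simps, OF W_deriv(1)[OF r]]]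
      zero[OF \<epsilon>_deriv[OF r Z_deriv(4)[OF r], unfolded server.simps, OF W_deriv(1)[OF r]]]
    by (simp_all add: w_def)
  have "w = 0 \<or> w * (1 + m $ K4 * \<delta> K3) = m $ K1 * \<alpha> + (m $ K3 + m $ K4) * d K2 - 1"
  proof (cases "W t $ S1 = 0")
    case True
    \<comment> \<open>A nonnegative function that vanishes at an interior time has a local minimum
      there.\<close>
    then have "\<forall>s. \<bar>t - s\<bar> < t \<longrightarrow> W t $ S1 \<le> W s $ S1" using W_nonneg by simp
    then have "w = 0" unfolding w_def using DERIV_local_min[OF W_deriv(1)[OF r], of t] t by simp
    then show ?thesis ..
  next
    case False
    then have full: "m $ K1 * d K1 + m $ K3 * d K3 + m $ K4 * d K4 = 1"
      using full_capacity[OF r] W_nonneg[of t S1] t by simp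
    have "w = m $ K1 * \<alpha> + m $ K3 * d K2 + m $ K4 * d K3 - (m $ K1 * d K1 + m $ K3 * d K3 + m $ K4 * d K4)"
      unfolding w_def by (simp add: algebra_simps)
    then have "w = m $ K1 * \<alpha> + m $ K3 * d K2 + m $ K4 * d K3 - 1" by (simp only: full)
    moreover have "d K3 = d K2 - \<delta> K3 * w" using eqs(2) by simp
    ultimately have "w = m $ K1 * \<alpha> + m $ K3 * d K2 + m $ K4 * (d K2 - \<delta> K3 * w) - 1" by simp
    then show ?thesis by (simp add: algebra_simps)
  qed
  with eqs show ?thesis by (rule that)
qed

text \<open>The danger is that station 1 sheds class 1 stock into class 2 faster than class 2
  drains. With class 2 served at rate \<open>1 / m $ K2\<close>, the third hypothesis makes the
  workload of station 1 nondecreasing, so the inflow is at most \<alpha>, below that rate.\<close>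

lemma eventually_\<epsilon>2_nonpos:
  assumes "\<alpha> < 1" "m $ K2 < 1" "m $ K2 * (1 - m $ K1 * \<alpha>) \<le> m $ K3 + m $ K4" "0 \<le> t\<^sub>0"
    and collapsed: "\<And>s. t\<^sub>0 \<le> s \<Longrightarrow> \<epsilon> s $ K1 = 0 \<and> \<epsilon> s $ K3 = 0 \<and> \<epsilon> s $ K4 = 0"
  shows "\<exists>t\<^sub>1\<ge>t\<^sub>0. \<forall>t\<ge>t\<^sub>1. \<epsilon> t $ K2 \<le> 0"
proof (cases "m $ K2 * \<delta> K2 = 1")
  case True
  then show ?thesis using \<epsilon>_nonpos_if_full_ratio \<open>0 \<le> t\<^sub>0\<close> by (meson order_refl order_trans)
next
  case False
  then have full: "m $ K2 * \<delta> K2 < 1"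
    using \<delta>_sums(2) m_\<delta>_nonneg[of K5] by linarith
  obtain L where L: "L-lipschitz_on {0..} (\<lambda>t. \<epsilon> t $ K2)" by (rule \<epsilon>_lipschitz)
  define c where "c = (1 / m $ K2 - \<alpha>) * (1 - m $ K2 * \<delta> K2)"
  have "1 < 1 / m $ K2" using m_pos[of K2] assms(2) by simp
  then have "c > 0"
    unfolding c_def using full assms(1) by (intro mult_pos_pos) simp_all
  show ?thesis
  proof (rule eventually_nonpos_if_rates[OF L \<open>0 \<le> t\<^sub>0\<close> \<open>c > 0\<close>])
    fix t d assume r: "departure_rates t d" and t: "t\<^sub>0 < t" "0 < \<epsilon> t $ K2"
    then have m2: "m $ K2 * d K2 = 1" using priority(4) by blast
    then have d: "d K2 = 1 / m $ K2" by (rule rate_eq)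
    have "d K5 = 0"
      using capacity(2)[OF r] m2 by (intro rate_eq_0[OF r]) simp
    obtain w where w: "\<alpha> - d K1 = \<delta> K1 * w"
      "w = 0 \<or> w * (1 + m $ K4 * \<delta> K3) = m $ K1 * \<alpha> + (m $ K3 + m $ K4) * d K2 - 1"
      using station1_collapsed_rates[OF r \<open>0 \<le> t\<^sub>0\<close> t(1) collapsed] by metis
    have "0 \<le> m $ K1 * \<alpha> + (m $ K3 + m $ K4) * d K2 - 1"
      unfolding d using assms(3) m_pos[of K2] by (simp add: field_simps)
    moreover have "0 < 1 + m $ K4 * \<delta> K3"
      using m_pos[of K4] \<delta>_nonneg[of K3] by (simp add: add_pos_nonneg)
    ultimately have "0 \<le> w" using w(2) by (metis zero_le_mult_iff order_refl not_less)
    then have "0 \<le> \<alpha> - d K1" unfolding w(1) using \<delta>_nonneg by simp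
    note \<epsilon>_deriv[OF r Z_deriv(2)[OF r], unfolded server.simps, OF W_deriv(2)[OF r]]
    moreover have "d K1 - d K2 - \<delta> K2 * (m $ K2 * (d K1 - d K2) + m $ K5 * (d K4 - d K5))
      = - c - ((\<alpha> - d K1) * (1 - m $ K2 * \<delta> K2) + \<delta> K2 * (m $ K5 * d K4))"
      unfolding c_def d[symmetric] by (simp add: \<open>d K5 = 0\<close> algebra_simps)
    moreover have "0 \<le> (\<alpha> - d K1) * (1 - m $ K2 * \<delta> K2) + \<delta> K2 * (m $ K5 * d K4)"
      using \<open>0 \<le> \<alpha> - d K1\<close> full \<delta>_nonneg m_pos[of K5] rates_nonneg[OF r]
      by (intro add_nonneg_nonneg mult_nonneg_nonneg) (simp_all add: less_imp_le)
    ultimately show "\<exists>D\<le>-c. ((\<lambda>t. \<epsilon> t $ K2) has_real_derivative D) (at t)"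
      by (metis diff_ge_0_iff_ge diff_le_eq add_increasing2 order_refl)
  qed
qed

text \<open>By the balance of deviations, class 5 is then above target and takes the whole of
  station 2. Station 1, cut off from class 2, does not gain workload, so class 2 receives at least
  \<alpha>. What has to be excluded is that the stock released into class 5 raises the workload of
  station 2, and with it the target of class 2, too fast.\<close>

lemma eventually_\<epsilon>2_nonneg:
  assumes "0 < \<alpha>" "m $ K1 * \<alpha> < 1" "m $ K5 * (1 - m $ K1 * \<alpha>) < m $ K4" "0 \<le> t\<^sub>0"
    and collapsed: "\<And>s. t\<^sub>0 \<le> s \<Longrightarrow> \<epsilon> s $ K1 = 0 \<and> \<epsilon> s $ K3 = 0 \<and> \<epsilon> s $ K4 = 0"
  shows "\<exists>t\<^sub>1\<ge>t\<^sub>0. \<forall>t\<ge>t\<^sub>1. - \<epsilon> t $ K2 \<le> 0"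
proof -
  obtain L where "L-lipschitz_on {0..} (\<lambda>t. \<epsilon> t $ K2)" by (rule \<epsilon>_lipschitz)
  then have L: "L-lipschitz_on {0..} (\<lambda>t. - \<epsilon> t $ K2)" by (simp add: lipschitz_on_def dist_minus)
  have x: "0 \<le> m $ K2 * \<delta> K2" "m $ K2 * \<delta> K2 \<le> 1"
    using \<delta>_sums(2) m_\<delta>_nonneg[of K2] m_\<delta>_nonneg[of K5] by linarith+
  have den: "0 < 1 + m $ K4 * \<delta> K3"
    using m_pos[of K4] \<delta>_nonneg[of K3] by (simp add: add_pos_nonneg)
  \<comment> \<open>The value of \<open>d K4\<close> when station 1 works at full capacity and class
    2 is idle, hence an upper bound for the inflow into class 5.\<close>
  define q where "q = (\<delta> K3 + \<delta> K4) * (1 - m $ K1 * \<alpha>) / (1 + m $ K4 * \<delta> K3)"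
  have "0 \<le> q" unfolding q_def using \<delta>_nonneg assms(2) den by simp
  have q: "m $ K5 * q < 1"
  proof -
    define u where "u = m $ K5 * (1 - m $ K1 * \<alpha>)"
    have u: "u < m $ K4" using assms(3) by (simp add: u_def)
    have sum: "m $ K3 * \<delta> K3 + m $ K4 * \<delta> K4 \<le> 1" using \<delta>_sums(1) m_\<delta>_nonneg[of K1] by linarith
    have le: "u * \<delta> K3 \<le> m $ K4 * \<delta> K3" "u * \<delta> K4 \<le> m $ K4 * \<delta> K4"
      using u \<delta>_nonneg by (simp_all add: mult_right_mono)
    have "u * \<delta> K3 + u * \<delta> K4 < 1 + m $ K4 * \<delta> K3"
    proof (cases "\<delta> K3 = 0")
      \<comment> \<open>Strictness needs the case split: for \<open>\<delta> K3 = 0\<close> it comes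
        from u being less than \<open>m $ K4\<close>, or is trivial if
        \<open>\<delta> K4 = 0\<close> as well; otherwise it comes from the positive share of class
        3.\<close>
      case True
      show ?thesis
      proof (cases "\<delta> K4 = 0")
        case False
        then have "u * \<delta> K4 < m $ K4 * \<delta> K4" using u \<delta>_nonneg[of K4] by simp
        then show ?thesis using True sum by simp
      qed (simp add: True)
    next
      case False
      then have "0 < m $ K3 * \<delta> K3" using m_pos[of K3] \<delta>_nonneg[of K3] by simp
      then show ?thesis using le sum by linarith
    qed
    then show ?thesis unfolding q_def using den by (simp add: u_def field_simps)
  qed
  define c where "c = \<alpha> * (1 - m $ K2 * \<delta> K2) + \<delta> K2 * (1 - m $ K5 * q)"
  have "c > 0"
  proof (cases "\<delta> K2 = 0")
    case True
    then show ?thesis using assms(1) by (simp add: c_def)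
  next
    case False
    then have "0 < \<delta> K2 * (1 - m $ K5 * q)" using \<delta>_nonneg[of K2] q by simp
    moreover have "0 \<le> \<alpha> * (1 - m $ K2 * \<delta> K2)" using assms(1) x by simp
    ultimately show ?thesis by (simp add: c_def)
  qed
  show ?thesis
  proof (rule eventually_nonpos_if_rates[OF L \<open>0 \<le> t\<^sub>0\<close> \<open>c > 0\<close>])
    fix t d assume r: "departure_rates t d" and t: "t\<^sub>0 < t" "0 < - \<epsilon> t $ K2"
    have "0 \<le> t" using t \<open>0 \<le> t\<^sub>0\<close> by simp
    have "m $ K2 * \<epsilon> t $ K2 < 0" using t(2) m_pos[of K2] by (simp add: mult_pos_neg)
    then have "0 < m $ K5 * \<epsilon> t $ K5" using \<epsilon>_balance(2)[OF \<open>0 \<le> t\<close>] by simp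
    then have "0 < \<epsilon> t $ K5" using m_pos[of K5] by (simp add: zero_less_mult_iff)
    then have m5: "m $ K5 * d K5 = 1" using priority(5)[OF r] t(2) by simp
    have "d K2 = 0"
      using capacity(2)[OF r] m5 by (intro rate_eq_0[OF r]) simp
    obtain w where w: "\<alpha> - d K1 = \<delta> K1 * w" "d K2 - d K3 = \<delta> K3 * w" "d K3 - d K4 = \<delta> K4 * w"
      "w = 0 \<or> w * (1 + m $ K4 * \<delta> K3) = m $ K1 * \<alpha> + (m $ K3 + m $ K4) * d K2 - 1"
      using station1_collapsed_rates[OF r \<open>0 \<le> t\<^sub>0\<close> t(1) collapsed] by metis
    then have w_cases: "w = 0 \<or> w = - ((1 - m $ K1 * \<alpha>) / (1 + m $ K4 * \<delta> K3))"
      using den \<open>d K2 = 0\<close> by (auto simp: field_simps)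
    moreover have "0 \<le> (1 - m $ K1 * \<alpha>) / (1 + m $ K4 * \<delta> K3)" using den assms(2) by simp
    ultimately have "w \<le> 0" by auto
    then have d1: "\<alpha> \<le> d K1" using w(1) mult_nonneg_nonpos[OF \<delta>_nonneg[of K1], of w] by simp
    have "d K4 = (\<delta> K3 + \<delta> K4) * - w" using w(2,3) \<open>d K2 = 0\<close> by (simp add: algebra_simps)
    then have d4: "d K4 \<le> q" using w_cases \<open>0 \<le> q\<close> by (auto simp: q_def)
    note \<epsilon>_deriv[OF r Z_deriv(2)[OF r], unfolded server.simps, OF W_deriv(2)[OF r]]
    note DERIV_minus[OF this]
    moreover have "- (d K1 - d K2 - \<delta> K2 * (m $ K2 * (d K1 - d K2) + m $ K5 * (d K4 - d K5)))
      = - c - ((d K1 - \<alpha>) * (1 - m $ K2 * \<delta> K2) + \<delta> K2 * (m $ K5 * (q - d K4)))"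
      using m5 unfolding c_def by (simp add: \<open>d K2 = 0\<close> algebra_simps)
    moreover have "0 \<le> (d K1 - \<alpha>) * (1 - m $ K2 * \<delta> K2) + \<delta> K2 * (m $ K5 * (q - d K4))"
      using d1 d4 x \<delta>_nonneg m_pos[of K5]
      by (intro add_nonneg_nonneg mult_nonneg_nonneg) (simp_all add: less_imp_le)
    ultimately show "\<exists>D\<le>-c. ((\<lambda>t. - \<epsilon> t $ K2) has_real_derivative D) (at t)"
      by (metis diff_ge_0_iff_ge diff_le_eq add_increasing2 order_refl)
  qed
qed

lemma collapse:
  assumes \<alpha>: "0 < \<alpha>" "\<alpha> < 1" and m: "m $ K1 < 1" "m $ K2 < 1" "m $ K3 < m $ K2"
    and heavy: "m $ K2 * (1 - m $ K1 * \<alpha>) \<le> m $ K3 + m $ K4" "m $ K5 * (1 - m $ K1 * \<alpha>) < m $ K4"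
  shows "\<exists>t\<^sub>0\<ge>0. \<forall>t\<ge>t\<^sub>0. Z t = \<Delta> *v W t"
proof -
  have "m $ K1 * \<alpha> < 1" using \<alpha> m(1) m_pos[of K1] mult_strict_mono[of "m $ K1" 1 \<alpha> 1] by simp
  obtain t\<^sub>1 where t1: "0 \<le> t\<^sub>1" "\<And>t. t\<^sub>1 \<le> t \<Longrightarrow> \<epsilon> t $ K1 = 0 \<and> \<epsilon> t $ K3 = 0 \<and> \<epsilon> t $ K4 = 0"
    using station1_collapse[OF \<alpha>(1) \<open>m $ K1 * \<alpha> < 1\<close> m(3)] by blast
  obtain t\<^sub>2 where t2: "t\<^sub>1 \<le> t\<^sub>2" "\<And>t. t\<^sub>2 \<le> t \<Longrightarrow> \<epsilon> t $ K2 \<le> 0"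
    using eventually_\<epsilon>2_nonpos[OF \<alpha>(2) m(2) heavy(1) t1] by blast
  obtain t\<^sub>3 where t3: "t\<^sub>1 \<le> t\<^sub>3" "\<And>t. t\<^sub>3 \<le> t \<Longrightarrow> - \<epsilon> t $ K2 \<le> 0"
    using eventually_\<epsilon>2_nonneg[OF \<alpha>(1) \<open>m $ K1 * \<alpha> < 1\<close> heavy(2) t1] by blast
  have "Z t = \<Delta> *v W t" if "max t\<^sub>2 t\<^sub>3 \<le> t" for t
  proof -
    have t: "0 \<le> t" "t\<^sub>1 \<le> t" "t\<^sub>2 \<le> t" "t\<^sub>3 \<le> t" using that t1 t2 t3 by auto
    have "\<epsilon> t $ K2 = 0" using t2(2)[OF t(3)] t3(2)[OF t(4)] by simp
    moreover from this have "\<epsilon> t $ K5 = 0" using \<epsilon>_balance(2)[OF t(1)] m_pos[of K5] by simp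
    ultimately have "\<epsilon> t = 0" using t1(2)[OF t(2)] by (simp add: vec_eq_iff all_job_class)
    then show ?thesis using \<epsilon>_eq_diff[OF t(1)] by simp
  qed
  then show ?thesis using t1 t2 by (meson max.cobounded1 order_trans)
qed

end

section \<open>Robust stability\<close>

text \<open>Entry (j, l) is the work still due at station j from a unit of workload at station l
  spread according to \<Delta>; each class contributes the service times along the rest of its
  route.\<close>

lemma reflection_inv_entries:
  assumes "ratio_matrix m \<Delta>"
  shows "reflection_inv m \<Delta> $ S1 $ S1 = (m $ K1 + m $ K3 + m $ K4) * \<Delta> $ K1 $ S1
      + (m $ K3 + m $ K4) * \<Delta> $ K3 $ S1 + m $ K4 * \<Delta> $ K4 $ S1"
    "reflection_inv m \<Delta> $ S1 $ S2 = (m $ K3 + m $ K4) * \<Delta> $ K2 $ S2"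
    "reflection_inv m \<Delta> $ S2 $ S1 = (m $ K2 + m $ K5) * \<Delta> $ K1 $ S1 + m $ K5 * \<Delta> $ K3 $ S1 + m $ K5 * \<Delta> $ K4 $ S1"
    "reflection_inv m \<Delta> $ S2 $ S2 = (m $ K2 + m $ K5) * \<Delta> $ K2 $ S2 + m $ K5 * \<Delta> $ K5 $ S2"
  using assms
  by (simp_all add: reflection_inv_def visits_eq matrix_matrix_mult_def sum_job_class
      constituency_def service_def ratio_matrix_def)

text \<open>The determinant is linear in the column of \<Delta> for station 1. After the
  normalizations, only the coefficient \<open>n4 - n3 * n5 * x2\<close> of class 4 involves a
  subtraction. Its worst case is \<open>x2 = 1 / n2\<close>, all work of station 2 being in class 2,
  and there positivity is precisely \<open>cond\<close>.\<close>

lemma reflection_inv_stable: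
  fixes m :: "real ^ job_class"
  assumes m_pos: "\<And>k. 0 < m $ k"
    and m_sums: "m $ K1 + m $ K3 + m $ K4 = 1" "m $ K2 + m $ K5 = 1"
    and cond: "m $ K3 * m $ K5 < m $ K2 * m $ K4"
    and ratio: "ratio_matrix m \<Delta>" and r: "r $ S1 < 0" "r $ S2 < 0"
  shows "invertible (reflection_inv m \<Delta>)"
    "skorohod_stable (matrix_inv (reflection_inv m \<Delta>)) (matrix_inv (reflection_inv m \<Delta>) *v r)"
proof -
  define x1 x2 x3 x4 x5 where x: "x1 = \<Delta> $ K1 $ S1" "x2 = \<Delta> $ K2 $ S2" "x3 = \<Delta> $ K3 $ S1"
    "x4 = \<Delta> $ K4 $ S1" "x5 = \<Delta> $ K5 $ S2"
  define n1 n2 n3 n4 n5 where n: "n1 = m $ K1" "n2 = m $ K2" "n3 = m $ K3" "n4 = m $ K4" "n5 = m $ K5"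
  have n_pos: "0 < n1" "0 < n2" "0 < n3" "0 < n4" "0 < n5" using m_pos by (simp_all add: n)
  have x_nonneg: "0 \<le> x1" "0 \<le> x2" "0 \<le> x3" "0 \<le> x4" "0 \<le> x5"
    using ratio by (simp_all add: x ratio_matrix_def)
  have n_sums: "n1 = 1 - n3 - n4" "n2 = 1 - n5" using m_sums by (simp_all add: n algebra_simps)
  have x_sums: "n1 * x1 + n3 * x3 + n4 * x4 = 1" "n2 * x2 + n5 * x5 = 1"
    using ratio_matrix_sums[OF ratio] by (simp_all add: n x)
  let ?G = "reflection_inv m \<Delta>"
  have G: "?G $ S1 $ S1 = x1 + (n3 + n4) * x3 + n4 * x4" "?G $ S1 $ S2 = (n3 + n4) * x2"
    "?G $ S2 $ S1 = x1 + n5 * x3 + n5 * x4" "?G $ S2 $ S2 = x2 + n5 * x5"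
    using reflection_inv_entries[OF ratio] m_sums by (simp_all add: n x)
  have G_diag: "0 < ?G $ S1 $ S1" "0 < ?G $ S2 $ S2"
  proof -
    \<comment> \<open>Since every \<open>n\<close> is less than 1, the entry dominates the
      normalized sum in \<open>x_sums\<close> and is therefore at least 1; likewise for the second
      diagonal entry.\<close>
    have "n1 * x1 \<le> x1" using n_sums n_pos x_nonneg by (intro mult_left_le_one_le) auto
    moreover have "0 \<le> n4 * x3" using n_pos x_nonneg by simp
    ultimately show "0 < ?G $ S1 $ S1" using x_sums(1) unfolding G by (simp add: algebra_simps)
    have "n2 * x2 \<le> x2" using n_sums n_pos x_nonneg by (intro mult_left_le_one_le) auto
    then show "0 < ?G $ S2 $ S2" using x_sums(2) unfolding G by simp
  qed
  have G_off: "0 \<le> ?G $ S1 $ S2" "0 \<le> ?G $ S2 $ S1"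
    unfolding G using n_pos x_nonneg by simp_all
  have expand: "?G $ S1 $ S1 * ?G $ S2 $ S2 - ?G $ S1 $ S2 * ?G $ S2 $ S1
    = x1 * (n1 * x2 + n5 * x5) + x3 * (n3 + n4) * (n2 * x2 + n5 * x5)
      + x4 * (n4 * (n2 * x2 + n5 * x5) - n3 * n5 * x2)"
    unfolding G n_sums by (simp add: algebra_simps)
  have c1: "0 < n1 * x2 + n5 * x5"
  proof (cases "x2 = 0")
    case True
    then show ?thesis using x_sums(2) by simp
  next
    case False
    then show ?thesis using n_pos x_nonneg by (simp add: add_pos_nonneg)
  qed
  have c4: "0 < n4 - n3 * n5 * x2"
  proof -
    have "n3 * n5 * (n2 * x2) \<le> n3 * n5 * 1"
    proof (rule mult_left_mono)
      have "0 \<le> n5 * x5" using n_pos x_nonneg by simp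
      then show "n2 * x2 \<le> 1" using x_sums(2) by linarith
    qed (use n_pos in simp)
    then have "n2 * (n3 * n5 * x2) < n2 * n4" using cond unfolding n[symmetric] by (simp add: mult_ac)
    then show ?thesis using n_pos by simp
  qed
  have "0 < x1 * (n1 * x2 + n5 * x5) + x3 * (n3 + n4) + x4 * (n4 - n3 * n5 * x2)"
  proof -
    have terms: "0 \<le> x1 * (n1 * x2 + n5 * x5)" "0 \<le> x3 * (n3 + n4)" "0 \<le> x4 * (n4 - n3 * n5 * x2)"
      using c1 c4 n_pos x_nonneg by simp_all
    have "x1 \<noteq> 0 \<or> x3 \<noteq> 0 \<or> x4 \<noteq> 0" using x_sums(1) by auto
    then have "0 < x1 * (n1 * x2 + n5 * x5) \<or> 0 < x3 * (n3 + n4) \<or> 0 < x4 * (n4 - n3 * n5 * x2)"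
      using c1 c4 n_pos x_nonneg by (auto simp: less_le[of 0 x1] less_le[of 0 x3] less_le[of 0 x4] zero_less_mult_iff)
    then show ?thesis using terms by linarith
  qed
  then have det: "0 < ?G $ S1 $ S1 * ?G $ S2 $ S2 - ?G $ S1 $ S2 * ?G $ S2 $ S1"
    unfolding expand x_sums by simp
  then show "invertible ?G" by (intro invertible_station_matrix) simp
  show "skorohod_stable (matrix_inv ?G) (matrix_inv ?G *v r)"
    using G_diag G_off det r by (intro skorohod_stable_if_det_pos) simp_all
qed

theorem corollary7:
  fixes m :: "real ^ job_class"
  assumes "\<And>k. 0 < m $ k"
    and "m $ K1 + m $ K3 + m $ K4 = 1"
    and "m $ K2 + m $ K5 = 1"
  shows "\<exists>\<alpha>bar. 0 < \<alpha>bar \<and> \<alpha>bar < 1 \<and>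
    (\<forall>\<alpha>\<^sub>1. \<alpha>bar < \<alpha>\<^sub>1 \<longrightarrow>
       load m \<alpha>\<^sub>1 $ S1 = load m \<alpha>\<^sub>1 $ S2 \<and> load m \<alpha>\<^sub>1 $ S1 < 1 \<longrightarrow>
       m $ K2 * m $ K4 > m $ K3 * m $ K5 \<longrightarrow>
       robustly_queue_ratio_stable m \<alpha>\<^sub>1)"
proof (cases "m $ K3 * m $ K5 < m $ K2 * m $ K4")
  case False
  \<comment> \<open>Any threshold will do: the implication to be shown has a false premise.\<close>
  then show ?thesis by (intro exI[of _ "1 / 2"]) simp
next
  case True
  have m_less: "m $ K1 < 1" "m $ K2 < 1" "m $ K3 + m $ K4 < 1"
    using assms(1)[of K1] assms(1)[of K3] assms(1)[of K4] assms(1)[of K5] assms(2,3) by linarith+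
  \<comment> \<open>Adding \<open>m $ K2 * m $ K3\<close> to both sides of the strict condition lets
    \<open>m $ K2 + m $ K5 = 1\<close> be used on the left.\<close>
  have "m $ K3 < m $ K2 * (m $ K3 + m $ K4)"
  proof -
    have "m $ K3 * (m $ K2 + m $ K5) < m $ K2 * (m $ K3 + m $ K4)"
      using True by (simp add: algebra_simps)
    then show ?thesis by (simp add: assms(3))
  qed
  also have "\<dots> < m $ K2 * 1" using m_less assms(1)[of K2] by (intro mult_strict_left_mono)
  finally have "m $ K3 < m $ K2" by simp
  \<comment> \<open>The two inequalities for the collapse of station 2 hold once
    \<open>1 - m $ K1 * \<alpha>\<close> is below \<mu>. At \<alpha> = 1 that quantity equals
    \<open>m $ K3 + m $ K4\<close>, so the next claim says that heavy traffic satisfies both with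
    room to spare.\<close>
  define \<mu> where "\<mu> = min ((m $ K3 + m $ K4) / m $ K2) (m $ K4 / m $ K5)"
  have "m $ K3 + m $ K4 < \<mu>"
  proof -
    have "m $ K2 * (m $ K3 + m $ K4) < 1 * (m $ K3 + m $ K4)"
      using m_less assms(1)[of K3] assms(1)[of K4] by (intro mult_strict_right_mono) auto
    moreover have "m $ K5 * (m $ K3 + m $ K4) < m $ K4 * (m $ K2 + m $ K5)"
      using True by (simp add: algebra_simps)
    ultimately show ?thesis
      using assms(1)[of K2] assms(1)[of K5] assms(3) by (simp add: \<mu>_def less_divide_eq mult.commute)
  qed
  \<comment> \<open>The second argument solves \<open>1 - m $ K1 * \<alpha> = \<mu>\<close> for
    \<alpha>. It is not positive if \<mu> is at least 1, hence the maximum with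
    \<open>1 / 2\<close>.\<close>
  define \<alpha>bar where "\<alpha>bar = max (1 / 2) ((1 - \<mu>) / m $ K1)"
  have "\<alpha>bar < 1"
    using \<open>m $ K3 + m $ K4 < \<mu>\<close> assms(1)[of K1] assms(2) by (simp add: \<alpha>bar_def)
  moreover have "0 < \<alpha>bar" by (simp add: \<alpha>bar_def less_max_iff_disj)
  moreover have "robustly_queue_ratio_stable m \<alpha>" if "\<alpha>bar < \<alpha>" "load m \<alpha> $ S1 < 1" for \<alpha>
  proof -
    have \<alpha>: "0 < \<alpha>" "\<alpha> < 1" using that \<open>0 < \<alpha>bar\<close> by (simp_all add: load_eq assms(2))
    have "(1 - \<mu>) / m $ K1 < \<alpha>" using that(1) by (simp add: \<alpha>bar_def)
    then have "1 - m $ K1 * \<alpha> < \<mu>" using assms(1)[of K1] by (simp add: field_simps)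
    then have "1 - m $ K1 * \<alpha> < (m $ K3 + m $ K4) / m $ K2" "1 - m $ K1 * \<alpha> < m $ K4 / m $ K5"
      by (simp_all add: \<mu>_def)
    then have heavy: "m $ K2 * (1 - m $ K1 * \<alpha>) \<le> m $ K3 + m $ K4" "m $ K5 * (1 - m $ K1 * \<alpha>) < m $ K4"
      using assms(1)[of K2] assms(1)[of K5] by (simp_all add: less_divide_eq mult.commute)
    show ?thesis unfolding robustly_queue_ratio_stable_def
    proof (intro allI impI conjI)
      fix \<Delta> assume ratio: "ratio_matrix m \<Delta>"
      show "state_space_collapse m \<alpha> \<Delta>" unfolding state_space_collapse_def
      proof (intro allI impI)
        fix Z W \<epsilon> T Y assume "fluid_solution m \<alpha> \<Delta> Z W \<epsilon> T Y"
        then interpret push_started_lu_kumar_fluid m \<alpha> \<Delta> Z W \<epsilon> T Y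
          using assms(1) ratio by unfold_locales
        show "\<exists>t\<^sub>0\<ge>0. \<forall>t\<ge>t\<^sub>0. Z t = \<Delta> *v W t"
          using \<alpha> m_less(1,2) \<open>m $ K3 < m $ K2\<close> heavy by (rule collapse)
      qed
      have "(load m \<alpha> - vec 1) $ S1 < 0" "(load m \<alpha> - vec 1) $ S2 < 0"
        using \<alpha> assms(2,3) by (simp_all add: load_eq)
      note stable = reflection_inv_stable[OF assms True ratio this]
      show "invertible (reflection_inv m \<Delta>)" by (rule stable(1))
      show "skorohod_stable (reflection m \<Delta>) (drift m \<alpha> \<Delta>)"
        unfolding drift_def reflection_def by (rule stable(2))
    qed
  qed
  ultimately show ?thesis by blast
qed

end
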